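(* Let $0<\lambda\le\Lambda$ and let $g:\mathbb{R}\to\mathbb{R}$ satisfy: (g1) $g$ is locally Lipschitz; (g2) $g$ is odd; (g3) there exists $\alpha\in(0,+\infty]$ such that $g$ is positive on $(0,\alpha)$ and negative on $(\alpha,+\infty)$. For any $\xi\in\mathbb{R}$ there exists a solution $u_\xi\in C^2([0,R_\xi))$ of the Cauchy problem $$\mathcal{M}^+_{\lambda,\Lambda}(u'')+g(u)=0,\qquad u(0)=\xi,\qquad u'(0)=0,$$ where $R_\xi\in(0,+\infty]$ is such that $[0,R_\xi)$ is the maximal interval where $u_\xi$ is defined. Moreover: (i) if $|\xi|=\alpha\in\mathbb{R}$ or $\xi=0$, then $u_\xi\equiv\xi$; (ii) if $\alpha\in\mathbb{R}$ and $|\xi|>\alpha$, then $|u_\xi|$ strictly increases to $+\infty$ on $[0,R_\xi)$; (iii) if $0<\xi<\alpha$, then: (a) if $\Lambda G(\xi)<\lambda G(\alpha)$, then $R_\xi=+\infty$ and $u_\xi$ is oscillating and periodic with $\|u_\xi\|_{L^\infty(\mathbb{R}_+)}=-u_\xi(r_2)<\alpha$, where $r_2$ is the first minimizer of $u_\xi$; (b) if $\Lambda G(\xi)=\lambda G(\alpha)$, then $R_\xi=+\infty$ and $-\alpha<u_\xi<\alpha$ in $\mathbb{R}_+$; moreover $u_\xi$ is decreasing in $\mathbb{R}_+$ and $\lim_{r\to+\infty}u_\xi(r)=-\alpha$; (c) if $\Lambda G(\xi)>\lambda G(\alpha)$, then $u_\xi$ decreases to $-\infty$ on $[0,R_\xi)$;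 (iv) if $-\alpha<\xi<0$, then $R_\xi=+\infty$ and $u_\xi$ is oscillating and periodic with $\|u_\xi\|_{L^\infty(\mathbb{R}_+)}=-\xi$.
   Context: In dimension one the Pucci operator is $\mathcal{M}^+_{\lambda,\Lambda}(u'')=\Lambda u''$ if $u''\ge0$ and $\mathcal{M}^+_{\lambda,\Lambda}(u'')=\lambda u''$ if $u''<0$. Notation: $G(t)=\int_0^t g(s)\,ds$; if $\alpha=+\infty$, $G(\alpha)$ means $\lim_{t\to+\infty}G(t)\in(0,+\infty]$. $\mathbb{R}_+=[0,+\infty)$. A solution is oscillating if it has an unbounded sequence of zeros. When $\alpha=+\infty$ the condition in (g3) on $(\alpha,+\infty)$ is void. *)

theory Defs
  imports "HOL-Probability.Essential_Supremum"
begin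

definition pucci_plus :: "real \<Rightarrow> real \<Rightarrow> real \<Rightarrow> real" where
  "pucci_plus lam Lam m = (if m \<ge> 0 then Lam * m else lam * m)"

definition half_open :: "ereal \<Rightarrow> real set" where
  "half_open R = {r. 0 \<le> r \<and> ereal r < R}"

(* u is a C^2 solution on [0,R), with one-sided derivatives at 0; values of u outside
   [0,R) are irrelevant. *)
definition cauchy_solution ::
    "real \<Rightarrow> real \<Rightarrow> (real \<Rightarrow> real) \<Rightarrow> real \<Rightarrow> ereal \<Rightarrow> (real \<Rightarrow> real) \<Rightarrow> bool" where
  "cauchy_solution lam Lam g \<xi> R u \<longleftrightarrow>
     0 < R \<and>
     (\<exists>u' u''.
        (\<forall>r\<in>half_open R. (u has_real_derivative u' r) (at r within half_open R)) \<and>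
        (\<forall>r\<in>half_open R. (u' has_real_derivative u'' r) (at r within half_open R)) \<and>
        continuous_on (half_open R) u'' \<and>
        (\<forall>r\<in>half_open R. pucci_plus lam Lam (u'' r) + g (u r) = 0) \<and>
        u 0 = \<xi> \<and> u' 0 = 0)"

definition maximal_solution ::
    "real \<Rightarrow> real \<Rightarrow> (real \<Rightarrow> real) \<Rightarrow> real \<Rightarrow> ereal \<Rightarrow> (real \<Rightarrow> real) \<Rightarrow> bool" where
  "maximal_solution lam Lam g \<xi> R u \<longleftrightarrow>
     cauchy_solution lam Lam g \<xi> R u \<and>
     \<not> (\<exists>R' v. R < R' \<and> cauchy_solution lam Lam g \<xi> R' v \<and> (\<forall>r\<in>half_open R. v r = u r))"

definition primitive :: "(real \<Rightarrow> real) \<Rightarrow> real \<Rightarrow> real" where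
  "primitive g t = (LBINT s=ereal 0..ereal t. g s)"

(* Only evaluated at arguments a > 0; for a = \<infinity> it is the limit of G at +\<infinity>. *)
definition primitive_ext :: "(real \<Rightarrow> real) \<Rightarrow> ereal \<Rightarrow> ereal" where
  "primitive_ext g a =
     (if a = \<infinity> then Lim at_top (\<lambda>t. ereal (primitive g t))
      else ereal (primitive g (real_of_ereal a)))"

(* The remaining notions concern functions on [0,+\<infinity>), i.e. solutions with R = \<infinity>. *)

definition oscillating :: "(real \<Rightarrow> real) \<Rightarrow> bool" where
  "oscillating u \<longleftrightarrow>
     (\<exists>z :: nat \<Rightarrow> real. (\<forall>n. 0 \<le> z n \<and> u (z n) = 0) \<and> \<not> bounded (range z))"

definition periodic_halfline :: "(real \<Rightarrow> real) \<Rightarrow> bool" where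
  "periodic_halfline u \<longleftrightarrow> (\<exists>T>0. \<forall>r\<ge>0. u (r + T) = u r)"

definition Linf_norm_halfline :: "(real \<Rightarrow> real) \<Rightarrow> ereal" where
  "Linf_norm_halfline u = esssup (lebesgue_on {0..}) (\<lambda>r. ereal \<bar>u r\<bar>)"

definition first_minimizer :: "(real \<Rightarrow> real) \<Rightarrow> real \<Rightarrow> bool" where
  "first_minimizer u r \<longleftrightarrow>
     is_arg_min u (\<lambda>s. 0 \<le> s) r \<and> (\<forall>s. is_arg_min u (\<lambda>s. 0 \<le> s) s \<longrightarrow> r \<le> s)"

end

theory Submission
  imports Defs
begin

text \<open>
  Solving the Pucci equation for the second derivative turns it into the autonomous equation
  \<open>u'' = f(u)\<close>, where \<open>f = - g / \<Lambda>\<close> where \<open>g \<le> 0\<close> and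
  \<open>f = - g / \<lambda>\<close> where \<open>g > 0\<close>. Such an \<open>f\<close> inherits local Lipschitz
  continuity from \<open>g\<close>, and with \<open>H' = - f\<close> the energy \<open>u'^2 / 2 + H(u)\<close> is
  constant along solutions. So the position can only take values with \<open>H(u) \<le> H(\<xi>)\<close>, and the
  velocity vanishes exactly where \<open>H(u) = H(\<xi>)\<close>. The whole classification is read off from the
  shape of \<open>H\<close>: a potential well with its bottom at 0 and rims at \<open>\<plusminus>\<alpha>\<close>,
  falling off outside, which equals \<open>G / \<lambda>\<close> on the right half of the well and
  \<open>G / \<Lambda>\<close> (at the reflected point) on the left half. It is this asymmetry that produces
  the comparison of \<open>\<Lambda> G(\<xi>)\<close> with \<open>\<lambda> G(\<alpha>)\<close>.

  Suppose \<open>f(\<xi>) < 0\<close> and let \<open>b\<close> be a level such that \<open>H < H(\<xi>)\<close> on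
  \<open>(b, \<xi>)\<close>. As long as the solution stays above \<open>b\<close> its velocity is negative
  (\<open>velocity_negative\<close>), and if it never leaves this region it approaches \<open>b\<close>, for
  otherwise its speed would stay bounded away from 0 (\<open>descent\<close>). Three things can happen.
  If \<open>b\<close> is a turning level that is not an equilibrium, it is reached in finite time, and
  reflecting the motion in time gives a periodic solution (\<open>periodic_solution\<close>). If \<open>b\<close>
  is an equilibrium on the same energy level, uniqueness forbids reaching it
  (\<open>avoids_equilibrium\<close>), and the solution converges to it monotonically. If there is no barrier,
  \<open>b = -\<infinity>\<close>, the solution escapes to \<open>-\<infinity>\<close>
  (\<open>unconfined_escape\<close>). Replacing \<open>u\<close> by \<open>-u\<close> covers the data with
  \<open>f(\<xi>) > 0\<close>, where the solution starts upwards.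

  Existence comes from the contraction principle on the whole half-line, applied to bounded Lipschitz
  truncations of \<open>f\<close>. A Gronwall estimate glues the solutions obtained in this way to one that is
  defined up to a time \<open>R\<close> and unbounded if \<open>R\<close> is finite
  (\<open>maximal_solution_exists\<close>). This alternative gives maximality at once, because an
  extension would be continuous, hence bounded, on \<open>[0, R]\<close>; and it reduces every claim
  \<open>R = \<infinity>\<close> to an a priori bound.
\<close>

section \<open>Global solutions for bounded Lipschitz forces\<close>

text \<open>
  The equation \<open>u'' = f(u)\<close> with \<open>u(0) = x\<close>, \<open>u'(0) = 0\<close>, written as a
  first-order system with velocity \<open>v\<close>. The derivatives are taken within the set of times, hence
  are one-sided at the end points of an interval.
\<close>

definition solves :: "(real \<Rightarrow> real) \<Rightarrow> real set \<Rightarrow> real \<Rightarrow> (real \<Rightarrow> real) \<Rightarrow> (real \<Rightarrow> real) \<Rightarrow> bool" where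
  "solves f S x u v \<longleftrightarrow>
     u 0 = x \<and> v 0 = 0 \<and>
     (\<forall>t\<in>S. (u has_real_derivative v t) (at t within S) \<and>
             (v has_real_derivative f (u t)) (at t within S))"

text \<open>
  For a function of one real variable this is local Lipschitz continuity: compact sets lie in
  symmetric intervals. The bounded intervals are the form in which it is used, to truncate \<open>f\<close>
  and to compare two solutions with values in a common interval.
\<close>

definition lipschitz_on_balls :: "(real \<Rightarrow> real) \<Rightarrow> bool" where
  "lipschitz_on_balls f \<longleftrightarrow> (\<forall>K. \<exists>L. L-lipschitz_on {-K..K} f)"

lemma lipschitz_on_balls_continuous:
  assumes "lipschitz_on_balls f"
  shows "continuous_on S f"
proof -
  have "isCont f x" for x
  proof -
    obtain L where L: "L-lipschitz_on {-(\<bar>x\<bar>+1)..\<bar>x\<bar>+1} f"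
      using assms unfolding lipschitz_on_balls_def by blast
    have "continuous_on {-(\<bar>x\<bar>+1)..\<bar>x\<bar>+1} f"
      by (rule lipschitz_on_continuous_on[OF L])
    moreover have "x \<in> interior {-(\<bar>x\<bar>+1)..\<bar>x\<bar>+1}"
      by (simp add: interior_atLeastAtMost_real abs_if)
    ultimately show ?thesis
      using continuous_on_interior by blast
  qed
  then show ?thesis
    by (simp add: continuous_at_imp_continuous_on)
qed

lemma solves_subset: "solves f S x u v \<Longrightarrow> T \<subseteq> S \<Longrightarrow> solves f T x u v"
  unfolding solves_def by (meson DERIV_subset subsetD)

lemma solves_derivD:
  assumes "solves f S x u v" "t \<in> S"
  shows "(u has_real_derivative v t) (at t within S)"
    "(v has_real_derivative f (u t)) (at t within S)"
  using assms unfolding solves_def by blast+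

text \<open>
  Integration divides a bound of the form \<open>K exp (c t)\<close> by \<open>c\<close>. In the norm weighted
  by \<open>exp (- c t)\<close>, integration from 0 therefore has norm at most \<open>1 / c\<close>, which makes
  the Picard operator a contraction for large \<open>c\<close> on the entire half-line at once.
\<close>

lemma integral_exp_weight_bound:
  fixes \<phi> :: "real \<Rightarrow> real"
  assumes "0 < c" "0 \<le> K" "0 \<le> t" and cont: "continuous_on {0..t} \<phi>"
    and bd: "\<And>s. s \<in> {0..t} \<Longrightarrow> \<bar>\<phi> s\<bar> \<le> K * exp (c * s)"
  shows "\<bar>integral {0..t} \<phi>\<bar> \<le> K / c * exp (c * t)"
proof -
  have "((\<lambda>s. K * exp (c * s)) has_integral (K / c * exp (c * t) - K / c * exp (c * 0))) {0..t}"
    using assms(1,3)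
    by (intro fundamental_theorem_of_calculus)
       (auto intro!: derivative_eq_intros simp flip: has_real_derivative_iff_has_vector_derivative)
  from integral_unique[OF this] has_integral_integrable[OF this]
  have I: "integral {0..t} (\<lambda>s. K * exp (c * s)) \<le> K / c * exp (c * t)"
    and int: "(\<lambda>s. K * exp (c * s)) integrable_on {0..t}"
    using assms(1,2) by (simp_all del: integral_mult_right)
  have "norm (integral {0..t} \<phi>) \<le> integral {0..t} (\<lambda>s. K * exp (c * s))"
    using bd by (intro integral_norm_bound_integral integrable_continuous_real cont int) auto
  with I show ?thesis by simp
qed

lemma integral_from_0_deriv:
  fixes \<phi> :: "real \<Rightarrow> real"
  assumes "continuous_on {0..} \<phi>" "0 \<le> t"
  shows "((\<lambda>t. integral {0..t} \<phi>) has_real_derivative \<phi> t) (at t within {0..})"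
proof -
  have "((\<lambda>t. integral {0..t} \<phi>) has_real_derivative \<phi> t) (at t within {0..t+1})"
    using assms by (intro integral_has_real_derivative) (auto intro: continuous_on_subset)
  moreover have "at t within {0..t+1} = at t within {0..}"
    by (rule at_within_nhd[of _ "{..<t+1}"]) auto
  ultimately show ?thesis by simp
qed

lemma integral_from_0_continuous:
  fixes \<phi> :: "real \<Rightarrow> real"
  assumes "continuous_on {0..} \<phi>"
  shows "continuous_on {0..} (\<lambda>t. integral {0..t} \<phi>)"
  using integral_from_0_deriv[OF assms] by (intro DERIV_continuous_on[where D = \<phi>]) auto

text \<open>
  Write \<open>u(t) = x + exp (c t) w(t)\<close> with \<open>w\<close> bounded and continuous. The equation for
  \<open>u\<close>, integrated twice, is a fixed point equation for \<open>w\<close> in the complete space of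
  bounded continuous functions, and the operator has Lipschitz constant at most \<open>L / c^2\<close>.
\<close>

lemma global_solution:
  fixes F :: "real \<Rightarrow> real"
  assumes lip: "L-lipschitz_on UNIV F" and bdd: "\<And>x. \<bar>F x\<bar> \<le> B"
  shows "\<exists>u v. solves F {0..} x u v"
proof -
  have L0: "0 \<le> L" using lip by (rule lipschitz_on_nonneg)
  have B0: "0 \<le> B" using bdd[of 0] by linarith
  \<comment> \<open>Any \<open>c > 0\<close> with \<open>c^2 > L\<close> makes the operator contract.\<close>
  define c where "c = L + 1"
  have c: "0 < c" "L / c / c < 1"
    using L0 by (auto simp: c_def divide_simps algebra_simps intro: add_pos_nonneg)
  have contF: "continuous_on UNIV F" using lip by (rule lipschitz_on_continuous_on)
  define Y where "Y w s = x + exp (c * s) * apply_bcontfun w s" for w :: "real \<Rightarrow>\<^sub>C real" and s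
  define V where "V w t = integral {0..t} (\<lambda>s. F (Y w s))" for w t
  define U where "U w t = integral {0..t} (V w)" for w t
  \<comment> \<open>The space consists of functions on the whole line, so negative times are frozen at 0.\<close>
  define \<Psi> where "\<Psi> w t = exp (- c * max 0 t) * U w (max 0 t)" for w t
  have contY: "continuous_on A (Y w)" for A w
    unfolding Y_def by (intro continuous_intros) auto
  have contFY: "continuous_on A (\<lambda>s. F (Y w s))" for A w
    using continuous_on_compose2[OF contF contY] by auto
  have contV: "continuous_on {0..} (V w)" for w
    unfolding V_def by (intro integral_from_0_continuous contFY)
  have contU: "continuous_on {0..} (U w)" for w
    unfolding U_def by (intro integral_from_0_continuous contV)
  have double: "\<bar>U w t\<bar> \<le> K / c / c * exp (c * t)"
    if "0 \<le> t" "0 \<le> K" "\<And>s. 0 \<le> s \<Longrightarrow> \<bar>F (Y w s)\<bar> \<le> K * exp (c * s)" for w t K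
    unfolding U_def
  proof (rule integral_exp_weight_bound)
    show "\<bar>V w s\<bar> \<le> K / c * exp (c * s)" if "s \<in> {0..t}" for s
      unfolding V_def using that \<open>0 \<le> K\<close> \<open>\<And>s. 0 \<le> s \<Longrightarrow> \<bar>F (Y w s)\<bar> \<le> K * exp (c * s)\<close> c
      by (intro integral_exp_weight_bound contFY) auto
  qed (use that c in \<open>auto intro: continuous_on_subset[OF contV]\<close>)
  have diff: "\<bar>U w t - U w' t\<bar> \<le> L * dist w w' / c / c * exp (c * t)"
    if "0 \<le> t" for w w' t
  proof -
    have V: "V w s - V w' s = integral {0..s} (\<lambda>s. F (Y w s) - F (Y w' s))" for s
      unfolding V_def by (intro integral_diff[symmetric] integrable_continuous_real contFY)
    have U: "U w t - U w' t = integral {0..t} (\<lambda>s. V w s - V w' s)"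
      unfolding U_def
      by (intro integral_diff[symmetric] integrable_continuous_real continuous_on_subset[OF contV]) auto
    show ?thesis unfolding U
    proof (rule integral_exp_weight_bound)
      show "\<bar>V w s - V w' s\<bar> \<le> L * dist w w' / c * exp (c * s)" if "s \<in> {0..t}" for s
        unfolding V
      proof (rule integral_exp_weight_bound)
        fix r assume "r \<in> {0..s}"
        have "\<bar>F (Y w r) - F (Y w' r)\<bar> \<le> L * \<bar>Y w r - Y w' r\<bar>"
          using lipschitz_onD[OF lip, of "Y w r" "Y w' r"] by (simp add: dist_real_def)
        also have "\<bar>Y w r - Y w' r\<bar> = exp (c * r) * dist (w r) (w' r)"
          by (simp add: Y_def dist_real_def abs_mult flip: right_diff_distrib)
        also have "L * (exp (c * r) * dist (w r) (w' r)) \<le> L * (exp (c * r) * dist w w')"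
          by (intro mult_left_mono dist_bounded L0) auto
        finally show "\<bar>F (Y w r) - F (Y w' r)\<bar> \<le> L * dist w w' * exp (c * r)"
          by (simp add: mult_ac)
      qed (use that c L0 in \<open>auto intro!: continuous_intros contFY\<close>)
    qed (use that c L0 in \<open>auto intro!: continuous_intros continuous_on_subset[OF contV]\<close>)
  qed
  have cont\<Psi>: "continuous_on UNIV (\<Psi> w)" for w
    unfolding \<Psi>_def
    by (intro continuous_intros continuous_on_compose2[OF contU]) auto
  have bdd\<Psi>: "norm (\<Psi> w t) \<le> B / c / c" for w t
  proof -
    have "\<bar>F (Y w s)\<bar> \<le> B * exp (c * s)" if "0 \<le> s" for s
    proof -
      have "1 \<le> exp (c * s)" using that c by simp
      then have "B * 1 \<le> B * exp (c * s)" using B0 by (intro mult_left_mono)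
      with bdd[of "Y w s"] show ?thesis by simp
    qed
    then have "\<bar>U w (max 0 t)\<bar> \<le> B / c / c * exp (c * max 0 t)"
      using B0 by (intro double) auto
    then show ?thesis
      by (simp add: \<Psi>_def abs_mult exp_minus field_simps)
  qed
  define \<Phi> where "\<Phi> w = Bcontfun (\<Psi> w)" for w
  have \<Phi>: "apply_bcontfun (\<Phi> w) = \<Psi> w" for w
    unfolding \<Phi>_def by (rule Bcontfun_inverse) (rule bcontfun_normI[OF cont\<Psi> bdd\<Psi>])
  have "\<exists>!w. \<Phi> w = w"
  proof (rule banach_fix_type)
    show "\<forall>w w'. dist (\<Phi> w) (\<Phi> w') \<le> L / c / c * dist w w'"
    proof (intro allI dist_bound)
      fix w w' t
      have "dist (\<Phi> w t) (\<Phi> w' t) = exp (- c * max 0 t) * \<bar>U w (max 0 t) - U w' (max 0 t)\<bar>"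
        by (simp add: \<Phi> \<Psi>_def dist_real_def abs_mult flip: right_diff_distrib)
      also have "\<dots> \<le> exp (- c * max 0 t) * (L * dist w w' / c / c * exp (c * max 0 t))"
        by (intro mult_left_mono diff) auto
      also have "\<dots> = L / c / c * dist w w'"
        by (simp add: exp_minus field_simps)
      finally show "dist (\<Phi> w t) (\<Phi> w' t) \<le> L / c / c * dist w w'" .
    qed
  qed (use c L0 in auto)
  then obtain w where w: "\<Phi> w = w" by blast
  have Yw: "Y w t = x + U w t" if "0 \<le> t" for t
  proof -
    have "w t = exp (- c * t) * U w t"
      using that fun_cong[OF \<Phi>[of w], of t] w by (simp add: \<Psi>_def)
    then show ?thesis by (simp add: Y_def exp_minus)
  qed
  have "solves F {0..} x (\<lambda>t. x + U w t) (V w)"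
    unfolding solves_def
  proof (intro conjI ballI)
    fix t :: real assume t: "t \<in> {0..}"
    have "((U w) has_real_derivative V w t) (at t within {0..})"
      using integral_from_0_deriv[OF contV] t by (simp add: U_def[abs_def])
    then show "((\<lambda>t. x + U w t) has_real_derivative V w t) (at t within {0..})"
      by (auto intro!: derivative_eq_intros)
    have "((V w) has_real_derivative F (Y w t)) (at t within {0..})"
      using integral_from_0_deriv[OF contFY] t by (simp add: V_def[abs_def])
    then show "((V w) has_real_derivative F (x + U w t)) (at t within {0..})"
      using t by (simp add: Yw)
  qed (auto simp: U_def V_def)
  then show ?thesis by blast
qed

section \<open>Uniqueness\<close>

text \<open>
  With \<open>a\<close> and \<open>b\<close> the differences of positions and velocities of two solutions and
  \<open>d\<close> the difference of the forces, this says that \<open>(a^2 + b^2) exp (- (1 + L) t)\<close> has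
  nonpositive derivative.
\<close>

lemma gronwall_estimate:
  fixes a b d L :: real
  assumes "0 \<le> L" "b * d \<le> \<bar>b\<bar> * (L * \<bar>a\<bar>)"
  shows "2 * a * b + 2 * b * d - (1 + L) * (a\<^sup>2 + b\<^sup>2) \<le> 0"
proof -
  have "2 * a * b + 2 * b * d - (1 + L) * (a\<^sup>2 + b\<^sup>2)
      = 2 * (b * d - \<bar>b\<bar> * (L * \<bar>a\<bar>)) - ((a - b)\<^sup>2 + L * (\<bar>a\<bar> - \<bar>b\<bar>)\<^sup>2)"
    by (simp add: power2_diff algebra_simps)
  also have "\<dots> \<le> 0"
  proof -
    have "0 \<le> (a - b)\<^sup>2 + L * (\<bar>a\<bar> - \<bar>b\<bar>)\<^sup>2"
      using assms(1) by simp
    then show ?thesis using assms(2) by argo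
  qed
  finally show ?thesis .
qed

text \<open>
  Derivatives are required only in the interior, with continuity up to the end points. In this form
  the lemma applies directly to time-shifted, time-reversed and constant solutions.
\<close>

lemma solutions_agree:
  assumes f: "lipschitz_on_balls f" and T: "0 \<le> T"
    and contu: "continuous_on {0..T} u" and contv: "continuous_on {0..T} v"
    and contp: "continuous_on {0..T} p" and contq: "continuous_on {0..T} q"
    and du: "\<And>t. 0 < t \<Longrightarrow> t < T \<Longrightarrow> (u has_real_derivative v t) (at t)"
    and dv: "\<And>t. 0 < t \<Longrightarrow> t < T \<Longrightarrow> (v has_real_derivative f (u t)) (at t)"
    and dp: "\<And>t. 0 < t \<Longrightarrow> t < T \<Longrightarrow> (p has_real_derivative q t) (at t)"
    and dq: "\<And>t. 0 < t \<Longrightarrow> t < T \<Longrightarrow> (q has_real_derivative f (p t)) (at t)"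
    and init: "u 0 = p 0" "v 0 = q 0"
  shows "u T = p T \<and> v T = q T"
proof -
  have "bounded (u ` {0..T} \<union> p ` {0..T})"
    using compact_continuous_image[OF contu] compact_continuous_image[OF contp]
    by (simp add: compact_imp_bounded)
  then obtain K where K: "\<And>z. z \<in> u ` {0..T} \<union> p ` {0..T} \<Longrightarrow> \<bar>z\<bar> \<le> K"
    unfolding bounded_iff by auto
  obtain L where L: "L-lipschitz_on {-K..K} f"
    using f unfolding lipschitz_on_balls_def by blast
  define e where "e t = (u t - p t)\<^sup>2 + (v t - q t)\<^sup>2" for t
  define E where "E t = e t * exp (- (1 + L) * t)" for t
  have "E T \<le> E 0"
  proof (rule DERIV_nonpos_imp_decreasing_open[OF T])
    show "continuous_on {0..T} E"
      unfolding E_def e_def by (intro continuous_intros contu contv contp contq)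
    fix t assume t: "0 < t" "t < T"
    let ?a = "u t - p t" and ?b = "v t - q t" and ?d = "f (u t) - f (p t)"
    have "(E has_real_derivative
        (2 * ?a * ?b + 2 * ?b * ?d - (1 + L) * e t) * exp (- (1 + L) * t)) (at t)"
      unfolding E_def e_def
      by (rule derivative_eq_intros du dv dp dq t refl)+ (simp add: algebra_simps power2_eq_square)
    moreover have "2 * ?a * ?b + 2 * ?b * ?d - (1 + L) * e t \<le> 0"
    proof -
      have "\<bar>?d\<bar> \<le> L * \<bar>?a\<bar>"
        using K[of "u t"] K[of "p t"] t lipschitz_onD[OF L, of "u t" "p t"]
        by (auto simp: dist_real_def abs_le_iff)
      then have X: "?b * ?d \<le> \<bar>?b\<bar> * (L * \<bar>?a\<bar>)"
        using mult_left_mono[of "\<bar>?d\<bar>" "L * \<bar>?a\<bar>" "\<bar>?b\<bar>"] abs_ge_self[of "?b * ?d"]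
        by (simp add: abs_mult)
      show ?thesis
        unfolding e_def by (rule gronwall_estimate[OF lipschitz_on_nonneg[OF L] X])
    qed
    ultimately show "\<exists>y. (E has_real_derivative y) (at t) \<and> y \<le> 0"
      by (meson exp_ge_zero mult_nonpos_nonneg)
  qed
  then have "e T * exp (- (1 + L) * T) \<le> 0" using init by (simp add: E_def e_def)
  then have "e T \<le> 0" by (simp add: mult_le_0_iff)
  then show ?thesis unfolding e_def
    by (metis add_nonneg_nonneg eq_iff_diff_eq_0 order_antisym sum_power2_eq_zero_iff zero_le_power2)
qed

lemma solves_interval_regularity:
  assumes "solves f {0..T} x u v"
  shows "continuous_on {0..T} u" "continuous_on {0..T} v"
    "\<And>t. 0 < t \<Longrightarrow> t < T \<Longrightarrow> (u has_real_derivative v t) (at t)"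
    "\<And>t. 0 < t \<Longrightarrow> t < T \<Longrightarrow> (v has_real_derivative f (u t)) (at t)"
proof -
  note u = solves_derivD(1)[OF assms] and v = solves_derivD(2)[OF assms]
  show "continuous_on {0..T} u" by (rule DERIV_continuous_on[OF u])
  show "continuous_on {0..T} v" by (rule DERIV_continuous_on[OF v])
  fix t assume t: "0 < t" "t < T"
  then have "at t within {0..T} = at t" by (intro at_within_interior) simp
  then show "(u has_real_derivative v t) (at t)" "(v has_real_derivative f (u t)) (at t)"
    using u[of t] v[of t] t by simp_all
qed

lemma solves_unique:
  assumes "lipschitz_on_balls f" "solves f {0..T} x u v" "solves f {0..T} x p q" "t \<in> {0..T}"
  shows "u t = p t \<and> v t = q t"
proof -
  have u: "solves f {0..t} x u v" and p: "solves f {0..t} x p q"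
    using assms by (auto elim!: solves_subset)
  show ?thesis
    using assms u p
    by (intro solutions_agree[OF assms(1)] solves_interval_regularity[OF u] solves_interval_regularity[OF p])
       (auto simp: solves_def)
qed

section \<open>Maximal solutions and the blow-up alternative\<close>

text \<open>
  Maximality is encoded by the blow-up alternative: if the life span \<open>R\<close> is finite, then the
  position is unbounded.
\<close>

definition maxsol :: "(real \<Rightarrow> real) \<Rightarrow> real \<Rightarrow> ereal \<Rightarrow> (real \<Rightarrow> real) \<Rightarrow> (real \<Rightarrow> real) \<Rightarrow> bool" where
  "maxsol f x R u v \<longleftrightarrow>
     0 < R \<and> solves f (half_open R) x u v \<and> (R < \<infinity> \<longrightarrow> \<not> bounded (u ` half_open R))"

text \<open>
  Clamping the argument to \<open>[-K, K]\<close> makes \<open>f\<close> bounded and globally Lipschitz.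
\<close>

lemma lipschitz_truncation:
  assumes f: "lipschitz_on_balls f" and K: "0 \<le> K"
  obtains F L B where "L-lipschitz_on UNIV F" "\<And>x. \<bar>F x\<bar> \<le> B" "\<And>x. \<bar>x\<bar> \<le> K \<Longrightarrow> F x = f x"
proof -
  define c where "c x = max (-K) (min K x)" for x :: real
  obtain L where L: "L-lipschitz_on {-K..K} f"
    using f unfolding lipschitz_on_balls_def by blast
  have c: "c x \<in> {-K..K}" "dist (c x) (c y) \<le> dist x y" for x y
    using K by (auto simp: c_def dist_real_def)
  have lip: "L-lipschitz_on UNIV (\<lambda>x. f (c x))"
  proof (rule lipschitz_onI)
    show "dist (f (c x)) (f (c y)) \<le> L * dist x y" for x y
      using lipschitz_onD[OF L c(1) c(1), of x y]
        mult_left_mono[OF c(2) lipschitz_on_nonneg[OF L], of x y] by linarith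
  qed (rule lipschitz_on_nonneg[OF L])
  have "compact (f ` {-K..K})"
    by (intro compact_continuous_image lipschitz_on_continuous_on[OF L]) auto
  from compact_imp_bounded[OF this] obtain B where "\<forall>y\<in>f ` {-K..K}. norm y \<le> B"
    unfolding bounded_iff by blast
  then have "\<bar>f (c x)\<bar> \<le> B" for x using c(1)[of x] by simp
  moreover have "f (c x) = f x" if "\<bar>x\<bar> \<le> K" for x
    using that by (auto simp: c_def)
  ultimately show thesis using lip that by blast
qed

lemma solves_cong:
  assumes "solves F S x u v" "\<And>t. t \<in> S \<Longrightarrow> F (u t) = f (u t)"
  shows "solves f S x u v"
  using assms unfolding solves_def by simp

text \<open>
  A solution for the truncated force solves the original equation as long as it stays below the
  truncation level, hence for some further time if the bound is strict.
\<close>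

lemma truncated_solution_continues:
  assumes w: "solves F {0..} x w z" and K: "\<And>x. \<bar>x\<bar> \<le> K \<Longrightarrow> F x = f x"
    and T: "0 \<le> T" and bd: "\<And>t. 0 \<le> t \<Longrightarrow> t \<le> T \<Longrightarrow> \<bar>w t\<bar> < K"
  obtains T' where "T < T'" "solves f {0..T'} x w z"
proof -
  have "continuous (at T within {0..}) w"
    using solves_derivD(1)[OF w] T by (intro DERIV_continuous) auto
  then obtain d where d: "0 < d" "\<And>t. 0 \<le> t \<Longrightarrow> dist t T < d \<Longrightarrow> dist (w t) (w T) < K - \<bar>w T\<bar>"
    using bd[of T] T unfolding continuous_within_eps_delta
    by (metis atLeast_iff diff_gt_0_iff_gt order_refl)
  have le: "\<bar>w t\<bar> \<le> K" if "t \<in> {0..T + d/2}" for t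
  proof (cases "t \<le> T")
    case True
    with that bd[of t] show ?thesis by auto
  next
    case False
    with that d(1) have "dist (w t) (w T) < K - \<bar>w T\<bar>"
      by (intro d(2)) (auto simp: dist_real_def)
    then show ?thesis by (simp add: dist_real_def)
  qed
  have "solves f {0..T + d/2} x w z"
    by (rule solves_cong[OF solves_subset[OF w]]) (use le K in auto)
  with d show thesis by (intro that[of "T + d/2"]) auto
qed

text \<open>
  Let \<open>R\<close> be the supremum of the times \<open>T\<close> such that a solution exists on
  \<open>[0, T]\<close>; by uniqueness all these solutions fit together. If \<open>R\<close> is finite and the
  solution is bounded by \<open>M\<close>, then it agrees up to \<open>R\<close> with the global solution for
  the force truncated at \<open>M + 1\<close>, which continues it beyond \<open>R\<close>, a contradiction. The
  same continuation argument at time 0 shows \<open>R > 0\<close>.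
\<close>

lemma maximal_solution_exists:
  assumes f: "lipschitz_on_balls f"
  obtains R u v where "maxsol f x R u v"
proof -
  define S where "S = {T. 0 < T \<and> (\<exists>u v. solves f {0..T} x u v)}"
  define R where "R = Sup (ereal ` S)"
  obtain p q where pq: "\<And>T. T \<in> S \<Longrightarrow> solves f {0..T} x (p T) (q T)"
  proof -
    have "\<forall>T\<in>S. \<exists>u v. solves f {0..T} x u v" unfolding S_def by blast
    then show thesis using that by metis
  qed
  have up: "ereal T \<le> R" if "T \<in> S" for T
    unfolding R_def using that by (intro Sup_upper) auto
  have ex: "\<exists>T\<in>S. t < T" if "ereal t < R" for t
    using that unfolding R_def less_Sup_iff by auto
  \<comment> \<open>The value at \<open>t\<close> is that of some solution living strictly beyond \<open>t\<close>.\<close>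
  define \<tau> where "\<tau> t = (SOME T. T \<in> S \<and> t < T)" for t
  have \<tau>: "\<tau> t \<in> S \<and> t < \<tau> t" if "ereal t < R" for t
    unfolding \<tau>_def by (rule someI_ex) (use ex[OF that] in auto)
  define u where "u t = p (\<tau> t) t" for t
  define v where "v t = q (\<tau> t) t" for t
  have agree: "u t = p T t \<and> v t = q T t" if "T \<in> S" "0 \<le> t" "t < T" for t T
  proof -
    have "ereal t < R" using that up[of T] by (meson ereal_less(1) less_ereal.simps(1) less_le_trans)
    with \<tau> have t: "\<tau> t \<in> S" "t < \<tau> t" by auto
    have "solves f {0..t} x (p (\<tau> t)) (q (\<tau> t))" "solves f {0..t} x (p T) (q T)"
      using pq[OF t(1)] pq[OF that(1)] t that by (auto elim!: solves_subset)
    from solves_unique[OF f this] that show ?thesis by (simp add: u_def v_def)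
  qed
  have short: "\<exists>T\<in>S. T > 0"
  proof -
    have "0 \<le> \<bar>x\<bar> + 1" by simp
    from lipschitz_truncation[OF f this] obtain F L B
      where F: "L-lipschitz_on UNIV F" "\<And>y. \<bar>F y\<bar> \<le> B"
        "\<And>y. \<bar>y\<bar> \<le> \<bar>x\<bar> + 1 \<Longrightarrow> F y = f y" by metis
    obtain w z where w: "solves F {0..} x w z"
      using global_solution[OF F(1,2)] by blast
    have "\<bar>w t\<bar> < \<bar>x\<bar> + 1" if "0 \<le> t" "t \<le> 0" for t
    proof -
      have "t = 0" "w 0 = x" using that w by (auto simp: solves_def)
      then show ?thesis by simp
    qed
    from truncated_solution_continues[OF w F(3) order_refl this]
    obtain T where "0 < T" "solves f {0..T} x w z" by blast
    then show ?thesis unfolding S_def by auto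
  qed
  then obtain T0 where T0: "T0 \<in> S" "0 < T0" by auto
  have R0: "0 < R" using up[OF T0(1)] T0(2) by (metis ereal_less(2) less_le_trans)
  have sol: "solves f (half_open R) x u v"
    unfolding solves_def
  proof (intro conjI ballI)
    show "u 0 = x" "v 0 = 0"
      using agree[OF T0(1), of 0] T0 pq[OF T0(1)] by (auto simp: solves_def)
    fix t assume t: "t \<in> half_open R"
    then obtain T where T: "T \<in> S" "t < T" using ex unfolding half_open_def by auto
    have *: "at t within half_open R = at t within {0..T}"
    proof (rule at_within_nhd)
      show "half_open R \<inter> {..<T} - {t} = {0..T} \<inter> {..<T} - {t}"
        using up[OF T(1)] by (auto simp: half_open_def intro: less_le_trans[of _ "ereal T"])
    qed (use T in auto)
    have t0: "0 \<le> t" using t by (simp add: half_open_def)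
    note D = solves_derivD[OF pq[OF T(1)], of t]
    show "(u has_real_derivative v t) (at t within half_open R)"
      unfolding *
    proof (rule has_field_derivative_transform_within[where d = "T - t"])
      show "(p T has_real_derivative v t) (at t within {0..T})"
        using D(1) agree[OF T(1) t0 T(2)] T t0 by simp
    qed (use agree[OF T(1)] T t0 in \<open>auto simp: dist_real_def\<close>)
    show "(v has_real_derivative f (u t)) (at t within half_open R)"
      unfolding *
    proof (rule has_field_derivative_transform_within[where d = "T - t"])
      show "(q T has_real_derivative f (u t)) (at t within {0..T})"
        using D(2) agree[OF T(1) t0 T(2)] T t0 by simp
    qed (use agree[OF T(1)] T t0 in \<open>auto simp: dist_real_def\<close>)
  qed
  have unb: "\<not> bounded (u ` half_open R)" if fin: "R < \<infinity>"
  proof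
    assume "bounded (u ` half_open R)"
    then obtain M where M: "\<And>t. t \<in> half_open R \<Longrightarrow> \<bar>u t\<bar> \<le> M"
      unfolding bounded_iff by auto
    obtain r where r: "R = ereal r" "0 < r" using R0 fin by (cases R) auto
    have "0 \<in> half_open R" using r by (simp add: half_open_def flip: zero_ereal_def)
    from M[OF this] have "0 \<le> M + 1" by linarith
    from lipschitz_truncation[OF f this] obtain F L B
      where F: "L-lipschitz_on UNIV F" "\<And>y. \<bar>F y\<bar> \<le> B"
        "\<And>y. \<bar>y\<bar> \<le> M + 1 \<Longrightarrow> F y = f y" by metis
    obtain w z where w: "solves F {0..} x w z"
      using global_solution[OF F(1,2)] by blast
    have lipF: "lipschitz_on_balls F"
      unfolding lipschitz_on_balls_def using lipschitz_on_subset[OF F(1)] by blast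
    have wu: "w t = u t" if "0 \<le> t" "t < r" for t
    proof -
      have sub: "{0..t} \<subseteq> half_open R" using that r by (auto simp: half_open_def)
      have "solves F {0..t} x u v"
        by (rule solves_cong[OF solves_subset[OF sol sub]]) (use sub M F(3) in force)
      from solves_unique[OF lipF solves_subset[OF w] this, of t] that show ?thesis by auto
    qed
    have contw: "continuous_on {0..r} w"
      using solves_interval_regularity(1)[OF solves_subset[OF w, of "{0..r}"]] by auto
    have "\<bar>w t\<bar> \<le> M" if "t \<in> closure {0<..<r}" for t
    proof (rule continuous_le_on_closure[where f = "\<lambda>t. \<bar>w t\<bar>"])
      show "continuous_on (closure {0<..<r}) (\<lambda>t. \<bar>w t\<bar>)"
        using r by (auto intro!: continuous_intros contw)
      show "\<bar>w t\<bar> \<le> M" if "t \<in> {0<..<r}" for t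
        using M[of t] wu[of t] that r by (auto simp: half_open_def)
    qed (rule that)
    then have "\<bar>w t\<bar> < M + 1" if "0 \<le> t" "t \<le> r" for t
      using that r by force
    from truncated_solution_continues[OF w F(3) less_imp_le[OF r(2)] this]
    obtain T where "r < T" "solves f {0..T} x w z" by blast
    then have "T \<in> S" unfolding S_def using r by auto
    from up[OF this] r \<open>r < T\<close> show False by simp
  qed
  from R0 sol unb show thesis by (intro that[of R u v]) (simp add: maxsol_def)
qed

lemma maxsol_imp_maximal_solution:
  assumes u: "maxsol f \<xi> R u v" and cont: "continuous_on UNIV f"
    and pucci: "\<And>x. pucci_plus lam Lam (f x) + g x = 0"
  shows "maximal_solution lam Lam g \<xi> R u"
proof -
  have R: "0 < R" and sol: "solves f (half_open R) \<xi> u v"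
    and unb: "R < \<infinity> \<Longrightarrow> \<not> bounded (u ` half_open R)"
    using u by (auto simp: maxsol_def)
  have contu: "continuous_on (half_open R) u"
    by (rule DERIV_continuous_on[OF solves_derivD(1)[OF sol]])
  have "continuous_on (half_open R) (\<lambda>t. f (u t))"
    by (rule continuous_on_compose2[OF cont contu]) auto
  note contf = this
  have "cauchy_solution lam Lam g \<xi> R u"
    unfolding cauchy_solution_def
    by (rule conjI[OF R], rule exI[of _ v], rule exI[of _ "\<lambda>t. f (u t)"])
       (use sol pucci contf in \<open>auto simp: solves_def\<close>)
  moreover have False if "R < R'" and w: "cauchy_solution lam Lam g \<xi> R' w"
    and eq: "\<forall>r\<in>half_open R. w r = u r" for R' w
  proof -
    obtain r where r: "R = ereal r" "0 < r" using R \<open>R < R'\<close> by (cases R) auto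
    have sub: "{0..r} \<subseteq> half_open R'" using r \<open>R < R'\<close>
      by (auto simp: half_open_def intro: le_less_trans[of _ "ereal r"])
    from w obtain w' where "\<forall>r\<in>half_open R'. (w has_real_derivative w' r) (at r within half_open R')"
      unfolding cauchy_solution_def by blast
    then have "continuous_on (half_open R') w" by (intro DERIV_continuous_on) auto
    then have "compact (w ` {0..r})"
      by (intro compact_continuous_image continuous_on_subset[OF _ sub]) auto
    then have "bounded (w ` {0..r})" by (rule compact_imp_bounded)
    moreover have "u ` half_open R \<subseteq> w ` {0..r}"
    proof
      fix y assume "y \<in> u ` half_open R"
      then obtain t where "t \<in> half_open R" "y = w t" using eq by auto
      then show "y \<in> w ` {0..r}" using r by (auto simp: half_open_def)
    qed
    ultimately show False using unb r bounded_subset by auto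
  qed
  ultimately show ?thesis unfolding maximal_solution_def by blast
qed

section \<open>Motion in a potential well\<close>

lemma zero_in_half_open: "0 < R \<Longrightarrow> 0 \<in> half_open R"
  by (simp add: half_open_def flip: zero_ereal_def)

lemma half_open_downward: "t \<in> half_open R \<Longrightarrow> 0 \<le> s \<Longrightarrow> s \<le> t \<Longrightarrow> s \<in> half_open R"
  by (auto simp: half_open_def intro: le_less_trans[of _ "ereal t"])

lemma maxsol_props:
  assumes "maxsol f x R u v"
  shows "0 < R" "u 0 = x" "v 0 = 0" "solves f (half_open R) x u v"
    "continuous_on (half_open R) u" "continuous_on (half_open R) v"
    "R < \<infinity> \<Longrightarrow> \<not> bounded (u ` half_open R)"
proof -
  show sol: "solves f (half_open R) x u v" and "0 < R"
    using assms by (auto simp: maxsol_def)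
  show "u 0 = x" "v 0 = 0" using sol by (auto simp: solves_def)
  show "continuous_on (half_open R) u"
    by (rule DERIV_continuous_on[OF solves_derivD(1)[OF sol]])
  show "continuous_on (half_open R) v"
    by (rule DERIV_continuous_on[OF solves_derivD(2)[OF sol]])
  show "R < \<infinity> \<Longrightarrow> \<not> bounded (u ` half_open R)" using assms by (simp add: maxsol_def)
qed

lemma maxsol_on_interval:
  assumes u: "maxsol f x R u v" and t: "t \<in> half_open R"
  shows "solves f {0..t} x u v"
  by (rule solves_subset[OF maxsol_props(4)[OF u]]) (use half_open_downward[OF t] in auto)

lemma maxsol_deriv:
  assumes u: "maxsol f x R u v" and t: "t \<in> half_open R" "0 < t"
  shows "(u has_real_derivative v t) (at t)" "(v has_real_derivative f (u t)) (at t)"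
proof -
  obtain T where T: "ereal t < ereal T" "ereal T < R"
    using t(1) unfolding half_open_def mem_Collect_eq by (meson ereal_dense2)
  then have "T \<in> half_open R" using t(2) by (auto simp: half_open_def)
  from maxsol_on_interval[OF u this] T t(2)
  show "(u has_real_derivative v t) (at t)" "(v has_real_derivative f (u t)) (at t)"
    by (auto intro: solves_interval_regularity)
qed

lemma maxsol_cont:
  assumes u: "maxsol f x R u v" and "0 \<le> s" "t \<in> half_open R"
  shows "continuous_on {s..t} u" "continuous_on {s..t} v"
  by (rule continuous_on_subset[OF maxsol_props(5)[OF u]] continuous_on_subset[OF maxsol_props(6)[OF u]],
      use assms in \<open>auto intro: half_open_downward\<close>)+

lemma maxsol_bounded_imp_global:
  assumes u: "maxsol f x R u v" and bd: "\<And>t. t \<in> half_open R \<Longrightarrow> a \<le> u t \<and> u t \<le> c"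
  shows "R = \<infinity>"
proof (rule ccontr)
  assume "R \<noteq> \<infinity>"
  then have "R < \<infinity>" by (simp add: less_top[symmetric] flip: top_ereal_def)
  moreover have "bounded (u ` half_open R)"
    by (rule bounded_subset[of "{a..c}"]) (use bd in auto)
  ultimately show False using maxsol_props(7)[OF u] by blast
qed

lemma half_open_infinity: "half_open \<infinity> = {0..}"
  by (auto simp: half_open_def)

text \<open>
  Here and below \<open>H\<close> is a potential of the force, \<open>H' = - f\<close>. Since the initial
  velocity is 0, the total energy is \<open>H(x)\<close>.
\<close>

lemma energy_conservation:
  assumes u: "maxsol f x R u v" and H: "\<And>y. (H has_real_derivative - f y) (at y)"
    and t: "t \<in> half_open R"
  shows "(v t)\<^sup>2 / 2 + H (u t) = H x"
proof (cases "t = 0")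
  case True
  then show ?thesis using maxsol_props[OF u] by simp
next
  case False
  then have t0: "0 < t" using t by (simp add: half_open_def)
  have contH: "continuous_on UNIV H"
    using H by (intro DERIV_continuous_on) auto
  have "(v t)\<^sup>2 / 2 + H (u t) = (v 0)\<^sup>2 / 2 + H (u 0)"
  proof (rule DERIV_isconst_end[OF t0])
    show "continuous_on {0..t} (\<lambda>t. (v t)\<^sup>2 / 2 + H (u t))"
      using t by (intro continuous_intros continuous_on_compose2[OF contH] maxsol_cont[OF u]) auto
    fix s assume s: "0 < s" "s < t"
    then have "s \<in> half_open R" by (intro half_open_downward[OF t]) auto
    note D = maxsol_deriv[OF u this s(1)]
    have "((\<lambda>s. H (u s)) has_real_derivative - f (u s) * v s) (at s)"
      by (rule DERIV_chain2[OF H D(1)])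
    moreover have "((\<lambda>s. (v s)\<^sup>2 / 2) has_real_derivative v s * f (u s)) (at s)"
      by (auto intro!: derivative_eq_intros D(2))
    ultimately show "((\<lambda>s. (v s)\<^sup>2 / 2 + H (u s)) has_real_derivative 0) (at s)"
      using DERIV_add by fastforce
  qed
  then show ?thesis using maxsol_props[OF u] by simp
qed

lemma first_zero:
  fixes \<phi> :: "real \<Rightarrow> real"
  assumes cont: "continuous_on {a..t} \<phi>" and "a \<le> t" "\<phi> a < 0" "0 \<le> \<phi> t"
  obtains T where "a < T" "T \<le> t" "\<phi> T = 0" "\<And>s. a \<le> s \<Longrightarrow> s < T \<Longrightarrow> \<phi> s < 0"
proof -
  define A where "A = {s \<in> {a..t}. \<phi> s \<in> {0..}}"
  have "A = {a..t} \<inter> \<phi> -` {0..}" unfolding A_def by auto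
  then have "closed A"
    using continuous_closed_preimage[OF cont, of "{0..}"] by simp
  moreover have "t \<in> A" "bdd_below A"
    unfolding A_def using assms by (auto simp: bdd_below_def)
  ultimately have T: "Inf A \<in> A" "\<And>s. s \<in> A \<Longrightarrow> Inf A \<le> s"
    using closed_contains_Inf[of A] by (auto intro: cInf_lower)
  then have neg: "\<phi> s < 0" if "a \<le> s" "s < Inf A" for s
    using that unfolding A_def by force
  have "\<exists>z\<ge>a. z \<le> Inf A \<and> \<phi> z = 0"
    using T(1) assms unfolding A_def
    by (intro IVT') (auto intro: continuous_on_subset[OF cont])
  with neg have "\<phi> (Inf A) = 0" by (metis less_irrefl order_le_less)
  with T neg assms show thesis
    by (intro that[of "Inf A"]) (auto simp: A_def order_less_le)
qed

text \<open>
  The velocity becomes negative immediately because \<open>f(x) < 0\<close>. At the first later time at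
  which it vanished the position would lie in \<open>(b, x)\<close>, where \<open>H < H(x)\<close>, whereas zero
  velocity forces \<open>H = H(x)\<close>.
\<close>

lemma velocity_negative:
  assumes u: "maxsol f x R u v" and H: "\<And>y. (H has_real_derivative - f y) (at y)"
    and fx: "f x < 0" and well: "\<And>y. b < ereal y \<Longrightarrow> y < x \<Longrightarrow> H y < H x"
    and t: "t \<in> half_open R" "0 < t" and ub: "\<And>s. 0 < s \<Longrightarrow> s \<le> t \<Longrightarrow> b < ereal (u s)"
  shows "v t < 0"
proof (rule ccontr)
  assume "\<not> v t < 0"
  have "(v has_real_derivative f x) (at 0 within half_open R)"
    using solves_derivD(2)[OF maxsol_props(4)[OF u], of 0] maxsol_props(1,2)[OF u]
    by (simp add: zero_in_half_open)
  from has_real_derivative_neg_dec_right[OF this fx]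
  obtain d where d: "0 < d" "\<And>h. 0 < h \<Longrightarrow> h \<in> half_open R \<Longrightarrow> h < d \<Longrightarrow> v h < 0"
    using maxsol_props(3)[OF u] by auto
  define e where "e = min (d / 2) t"
  have e: "0 < e" "e \<le> t" "e < d" using d(1) t(2) by (auto simp: e_def)
  have ve: "v s < 0" if "0 < s" "s \<le> e" for s
    using that e by (intro d(2) half_open_downward[OF t(1)]) auto
  obtain T where T: "e < T" "T \<le> t" "v T = 0" "\<And>s. e \<le> s \<Longrightarrow> s < T \<Longrightarrow> v s < 0"
    by (rule first_zero[of e t v])
       (use e ve[of e] t \<open>\<not> v t < 0\<close> in \<open>auto intro: maxsol_cont(2)[OF u]\<close>)
  have TR: "T \<in> half_open R" using T e by (intro half_open_downward[OF t(1)]) auto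
  have "u T < u 0"
  proof (rule DERIV_neg_imp_decreasing_open[where f = u])
    show "\<exists>y. (u has_real_derivative y) (at s) \<and> y < 0" if "0 < s" "s < T" for s
    proof (intro exI[of _ "v s"] conjI)
      show "v s < 0" using that ve T(4)[of s] by (cases "s \<le> e") auto
      show "(u has_real_derivative v s) (at s)"
        using that by (intro maxsol_deriv[OF u] half_open_downward[OF TR]) auto
    qed
  qed (use T e TR in \<open>auto intro: maxsol_cont(1)[OF u]\<close>)
  then have "H (u T) < H x"
    using maxsol_props(2)[OF u] T e by (intro well ub) auto
  with energy_conservation[OF u H TR] T(3) show False by simp
qed

text \<open>
  If the solution never went below some \<open>c > b\<close>, it would be bounded, hence global, and from time
  1 on it would stay in the compact interval \<open>[c, u(1)]\<close>, where \<open>H\<close> is at most some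
  value less than \<open>H(x)\<close>. By energy conservation the speed would be bounded away from 0, which is
  impossible for a bounded decreasing function.
\<close>

lemma descent:
  assumes u: "maxsol f x R u v" and H: "\<And>y. (H has_real_derivative - f y) (at y)"
    and fx: "f x < 0" and well: "\<And>y. b < ereal y \<Longrightarrow> y < x \<Longrightarrow> H y < H x"
    and ub: "\<And>t. t \<in> half_open R \<Longrightarrow> b < ereal (u t)"
  shows "\<And>t. t \<in> half_open R \<Longrightarrow> 0 < t \<Longrightarrow> v t < 0"
    and "strict_antimono_on (half_open R) u"
    and "\<And>c. b < ereal c \<Longrightarrow> \<exists>t\<in>half_open R. u t < c"
proof -
  show v: "v t < 0" if "t \<in> half_open R" "0 < t" for t
  proof (rule velocity_negative[OF u H fx well that])
    show "b < ereal (u s)" if "0 < s" "s \<le> t" for s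
      using that half_open_downward[OF \<open>t \<in> half_open R\<close>, of s] by (intro ub) auto
  qed
  have dec: "u t < u s" if "s \<in> half_open R" "t \<in> half_open R" "s < t" for s t
  proof (rule DERIV_neg_imp_decreasing_open[OF that(3)])
    have s0: "0 \<le> s" using that by (simp add: half_open_def)
    then show "continuous_on {s..t} u" using that by (intro maxsol_cont[OF u]) auto
    fix r assume r: "s < r" "r < t"
    then have "r \<in> half_open R" "0 < r" using s0 half_open_downward[OF that(2), of r] by auto
    then show "\<exists>y. (u has_real_derivative y) (at r) \<and> y < 0"
      using v maxsol_deriv(1)[OF u] by blast
  qed
  then show "strict_antimono_on (half_open R) u"
    by (intro monotone_onI) auto
  show "\<exists>t\<in>half_open R. u t < c" if c: "b < ereal c" for c
  proof (rule ccontr)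
    assume "\<not> (\<exists>t\<in>half_open R. u t < c)"
    then have low: "c \<le> u t" if "t \<in> half_open R" for t using that by force
    have x0: "u 0 = x" by (rule maxsol_props(2)[OF u])
    have zero: "0 \<in> half_open R" by (rule zero_in_half_open[OF maxsol_props(1)[OF u]])
    have le: "u t \<le> x" if "t \<in> half_open R" for t
      using dec[OF zero that] x0 that by (cases "t = 0") (auto simp: half_open_def)
    have R: "R = \<infinity>" by (rule maxsol_bounded_imp_global[OF u]) (use low le in blast)
    note [simp] = R half_open_infinity
    have u1: "c \<le> u 1" "u 1 < x" using low[of 1] dec[of 0 1] x0 by auto
    have "continuous_on {c..u 1} H"
      using H by (intro DERIV_continuous_on[where D = "\<lambda>y. - f y"]) (auto intro: DERIV_subset)
    then obtain y where y: "y \<in> {c..u 1}" "\<And>z. z \<in> {c..u 1} \<Longrightarrow> H z \<le> H y"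
      using continuous_attains_sup[of "{c..u 1}" H] u1 by auto
    have "ereal c \<le> ereal y" using y(1) by simp
    then have "H y < H x" using y(1) u1 c by (intro well) (auto intro: less_le_trans)
    define k where "k = sqrt (2 * (H x - H y))"
    have k: "0 < k" "k\<^sup>2 = 2 * (H x - H y)" using \<open>H y < H x\<close> by (auto simp: k_def)
    have vk: "v t \<le> - k" if "1 \<le> t" for t
    proof -
      have "u t \<in> {c..u 1}" using low[of t] dec[of 1 t] that by (cases "t = 1") auto
      from y(2)[OF this] have "k\<^sup>2 \<le> (- v t)\<^sup>2"
        using energy_conservation[OF u H, of t] that k(2) by (simp add: field_simps)
      then have "k \<le> - v t"
        by (rule power2_le_imp_le) (use v[of t] that in auto)
      then show ?thesis by simp
    qed
    \<comment> \<open>At speed at least \<open>k\<close> this is late enough to have passed below \<open>c\<close>.\<close>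
    define t where "t = 1 + (x - c + 1) / k"
    have t1: "1 \<le> t" using u1 k by (auto simp: t_def)
    have "u t + k * t \<le> u 1 + k * 1"
    proof (rule DERIV_nonpos_imp_decreasing_open[OF t1])
      show "continuous_on {1..t} (\<lambda>t. u t + k * t)"
        using t1 by (intro continuous_intros maxsol_cont[OF u]) auto
      fix s assume s: "1 < s" "s < t"
      have "((\<lambda>t. u t + k * t) has_real_derivative v s + k) (at s)"
        using maxsol_deriv(1)[OF u, of s] s by (auto intro!: derivative_eq_intros)
      then show "\<exists>y. ((\<lambda>t. u t + k * t) has_real_derivative y) (at s) \<and> y \<le> 0"
        using vk[of s] s by (intro exI[of _ "v s + k"]) auto
    qed
    moreover have "k * t = k + (x - c + 1)" using k(1) by (simp add: t_def field_simps)
    ultimately show False using low[of t] t1 u1 by auto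
  qed
qed

text \<open>
  If \<open>b\<close> were never reached, the solution would converge to \<open>b\<close>, where the force is
  positive; the acceleration would eventually exceed a positive constant, and the velocity would become
  positive.
\<close>

lemma first_hitting:
  assumes u: "maxsol f x R u v" and H: "\<And>y. (H has_real_derivative - f y) (at y)"
    and contf: "continuous_on UNIV f"
    and fx: "f x < 0" and fb: "0 < f b" and bx: "b < x"
    and well: "\<And>y. b < y \<Longrightarrow> y < x \<Longrightarrow> H y < H x"
  obtains T where "0 < T" "T \<in> half_open R" "u T = b" "\<And>s. 0 \<le> s \<Longrightarrow> s < T \<Longrightarrow> b < u s"
proof -
  have "\<exists>t\<in>half_open R. u t \<le> b"
  proof (rule ccontr)
    assume "\<not> (\<exists>t\<in>half_open R. u t \<le> b)"
    then have ub: "ereal b < ereal (u t)" if "t \<in> half_open R" for t using that by force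
    have well': "H y < H x" if "ereal b < ereal y" "y < x" for y using well that by simp
    have v: "v t < 0" if "t \<in> half_open R" "0 < t" for t
      by (rule descent(1)[OF u H fx well' ub that])
    have mono: "strict_antimono_on (half_open R) u"
      by (rule descent(2)[OF u H fx well' ub])
    have low: "\<exists>t\<in>half_open R. u t < c" if "ereal b < ereal c" for c
      by (rule descent(3)[OF u H fx well' ub that])
    have zero: "0 \<in> half_open R" by (rule zero_in_half_open[OF maxsol_props(1)[OF u]])
    have dec: "u t < u s" if "s \<in> half_open R" "t \<in> half_open R" "s < t" for s t
      using monotone_onD[OF mono] that by blast
    have le: "u t \<le> x" if "t \<in> half_open R" for t
      using dec[OF zero that] maxsol_props(2)[OF u] that by (cases "t = 0") (auto simp: half_open_def)
    have R: "R = \<infinity>"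
      by (rule maxsol_bounded_imp_global[OF u, of b x]) (use ub le in \<open>auto intro: less_imp_le\<close>)
    note [simp] = R half_open_infinity
    have "isCont f b" using contf by (simp add: continuous_on_eq_continuous_at)
    then obtain d where d: "0 < d" "\<And>y. dist y b < d \<Longrightarrow> dist (f y) (f b) < f b / 2"
      using fb unfolding continuous_at_eps_delta by (metis half_gt_zero)
    have "\<exists>t\<in>half_open R. u t < b + d" using d(1) by (intro low) simp
    then obtain t0 where t0: "0 \<le> t0" "u t0 < b + d" by auto
    have acc: "f b / 2 < f (u t)" if "t0 \<le> t" for t
    proof -
      have "u t < b + d" using dec[of t0 t] t0 that by (cases "t = t0") auto
      then have "dist (u t) b < d" using ub[of t] t0 that by (auto simp: dist_real_def)
      from d(2)[OF this] show ?thesis unfolding dist_real_def by argo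
    qed
    \<comment> \<open>With acceleration at least \<open>f(b) / 2\<close> the velocity has become positive by this time.\<close>
    define t where "t = t0 + (1 + 2 * \<bar>v t0\<bar> / f b)"
    have tt: "t0 < t" using fb by (auto simp: t_def add_pos_nonneg)
    have "- v t + f b / 2 * t \<le> - v t0 + f b / 2 * t0"
    proof (rule DERIV_nonpos_imp_decreasing_open[where f = "\<lambda>t. - v t + f b / 2 * t"])
      show "continuous_on {t0..t} (\<lambda>t. - v t + f b / 2 * t)"
        using t0 tt by (intro continuous_intros maxsol_cont[OF u]) auto
      fix s assume s: "t0 < s" "s < t"
      have "((\<lambda>t. - v t + f b / 2 * t) has_real_derivative - f (u s) + f b / 2) (at s)"
        using maxsol_deriv(2)[OF u, of s] s t0 by (auto intro!: derivative_eq_intros)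
      then show "\<exists>y. ((\<lambda>t. - v t + f b / 2 * t) has_real_derivative y) (at s) \<and> y \<le> 0"
        using acc[of s] s by (intro exI[of _ "- f (u s) + f b / 2"]) auto
    qed (use tt in simp)
    moreover have "f b / 2 * t = f b / 2 * t0 + f b / 2 + \<bar>v t0\<bar>"
      using fb by (simp add: t_def field_simps)
    ultimately have "0 < v t" using fb by linarith
    moreover have "v t < 0" using v[of t] t0 tt by simp
    ultimately show False by simp
  qed
  then obtain t where t: "t \<in> half_open R" "u t \<le> b" by blast
  obtain T where T: "0 < T" "T \<le> t" "b - u T = 0" "\<And>s. 0 \<le> s \<Longrightarrow> s < T \<Longrightarrow> b - u s < 0"
    by (rule first_zero[of 0 t "\<lambda>s. b - u s"])
       (use t maxsol_props(2)[OF u] bx in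
         \<open>auto simp: half_open_def intro!: continuous_intros intro: maxsol_cont(1)[OF u]\<close>)
  show thesis
  proof (rule that[of T])
    show "T \<in> half_open R" using T by (intro half_open_downward[OF t(1)]) auto
    show "b < u s" if "0 \<le> s" "s < T" for s using T(4)[OF that] by simp
  qed (use T in auto)
qed

text \<open>
  Just outside \<open>[b, x]\<close> the potential exceeds \<open>H(x)\<close>, because its slope is positive
  at \<open>x\<close> and negative at \<open>b\<close>. By energy conservation the solution cannot take such values, and by
  continuity it cannot jump across them.
\<close>

lemma stays_between_turning_levels:
  assumes u: "maxsol f x R u v" and H: "\<And>y. (H has_real_derivative - f y) (at y)"
    and fx: "f x < 0" and fb: "0 < f b" and bx: "b < x" and Hb: "H b = H x"
    and t: "t \<in> half_open R"
  shows "b \<le> u t \<and> u t \<le> x"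
proof -
  have t0: "0 \<le> t" using t by (simp add: half_open_def)
  have u0: "u 0 = x" by (rule maxsol_props(2)[OF u])
  have cont: "continuous_on {0..t} u" using t by (intro maxsol_cont[OF u]) auto
  have energy: "H (u s) \<le> H x" if "0 \<le> s" "s \<le> t" for s
    using energy_conservation[OF u H half_open_downward[OF t that]]
    by (metis add_increasing dual_order.refl zero_le_divide_iff zero_le_numeral zero_le_power2)
  have "\<not> x < u t"
  proof
    assume "x < u t"
    obtain d where d: "0 < d" "\<And>h. 0 < h \<Longrightarrow> h < d \<Longrightarrow> H x < H (x + h)"
      using DERIV_pos_inc_right[OF H] fx by (metis neg_0_less_iff_less)
    define y where "y = min (u t) (x + d / 2)"
    have y: "x < y" "y \<le> u t" "y - x < d" using \<open>x < u t\<close> d(1) by (auto simp: y_def)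
    obtain s where "0 \<le> s" "s \<le> t" "u s = y"
      using IVT'[of u 0 y t] y t0 u0 cont by auto
    with energy have "H y \<le> H x" by blast
    with d(2)[of "y - x"] y show False by simp
  qed
  moreover have "\<not> u t < b"
  proof
    assume "u t < b"
    have "- f b < 0" using fb by simp
    from DERIV_neg_dec_left[OF H this]
    obtain d where d: "0 < d" "\<And>h. 0 < h \<Longrightarrow> h < d \<Longrightarrow> H b < H (b - h)" by blast
    define y where "y = max (u t) (b - d / 2)"
    have y: "y < b" "u t \<le> y" "b - y < d" using \<open>u t < b\<close> d(1) by (auto simp: y_def)
    obtain s where "0 \<le> s" "s \<le> t" "u s = y"
      using IVT2'[of u t y 0] y t0 u0 cont bx by auto
    with energy have "H y \<le> H x" by blast
    with d(2)[of "b - y"] y Hb show False by simp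
  qed
  ultimately show ?thesis by auto
qed

lemma time_reversal:
  assumes u: "maxsol f x R u v" and T: "T \<in> half_open R" and s: "0 < s" "s < T"
  shows "((\<lambda>s. u (T - s)) has_real_derivative - v (T - s)) (at s)"
    and "((\<lambda>s. - v (T - s)) has_real_derivative f (u (T - s))) (at s)"
proof -
  have "T - s \<in> half_open R" using s by (intro half_open_downward[OF T]) auto
  note D = maxsol_deriv[OF u this]
  have "((\<lambda>s. T - s) has_real_derivative - 1) (at s)" by (auto intro!: derivative_eq_intros)
  from DERIV_chain2[OF D(1) this] DERIV_minus[OF DERIV_chain2[OF D(2) this]] s
  show "((\<lambda>s. u (T - s)) has_real_derivative - v (T - s)) (at s)"
    "((\<lambda>s. - v (T - s)) has_real_derivative f (u (T - s))) (at s)"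
    by simp_all
qed

lemma time_reversal_continuous:
  assumes u: "maxsol f x R u v" and T: "T \<in> half_open R"
  shows "continuous_on {0..T} (\<lambda>s. u (T - s))" "continuous_on {0..T} (\<lambda>s. - v (T - s))"
  by (intro continuous_intros continuous_on_compose2[OF maxsol_cont(1)[OF u order_refl T]]
       continuous_on_compose2[OF maxsol_cont(2)[OF u order_refl T]]; auto)+

text \<open>
  At the first hitting time \<open>T\<close> of \<open>b\<close> the velocity is 0, so the forward and the
  backward motion from time \<open>T\<close> have the same initial data: \<open>u(T + s) = u(T - s)\<close>. At
  time \<open>2 T\<close> the initial data recur.
\<close>

lemma periodic_solution:
  assumes f: "lipschitz_on_balls f"
    and u: "maxsol f x R u v" and H: "\<And>y. (H has_real_derivative - f y) (at y)"
    and fx: "f x < 0" and fb: "0 < f b" and bx: "b < x" and Hb: "H b = H x"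
    and well: "\<And>y. b < y \<Longrightarrow> y < x \<Longrightarrow> H y < H x"
  obtains T where "R = \<infinity>" "0 < T" "u T = b" "\<And>s. 0 \<le> s \<Longrightarrow> s < T \<Longrightarrow> b < u s"
    "\<And>s. 0 \<le> s \<Longrightarrow> u (s + 2 * T) = u s" "\<And>s. 0 \<le> s \<Longrightarrow> b \<le> u s \<and> u s \<le> x"
proof -
  note trap = stays_between_turning_levels[OF u H fx fb bx Hb]
  have R: "R = \<infinity>" by (rule maxsol_bounded_imp_global[OF u trap])
  note [simp] = R half_open_infinity
  obtain T where T: "0 < T" "T \<in> half_open R" "u T = b" "\<And>s. 0 \<le> s \<Longrightarrow> s < T \<Longrightarrow> b < u s"
    by (rule first_hitting[OF u H lipschitz_on_balls_continuous[OF f] fx fb bx well]) auto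
  have vT: "v T = 0" using energy_conservation[OF u H T(2)] T(3) Hb by simp
  have shift: "((\<lambda>s. u (c + s)) has_real_derivative v (c + s)) (at s)"
      "((\<lambda>s. v (c + s)) has_real_derivative f (u (c + s))) (at s)" if "0 < c" "0 < s" for c s
    using maxsol_deriv[OF u, of "s + c"] that unfolding DERIV_shift by (simp_all add: add.commute)
  have contshift: "continuous_on {0..r} (\<lambda>s. u (c + s))" "continuous_on {0..r} (\<lambda>s. v (c + s))"
    if "0 < c" for c r
    using that by (intro continuous_on_compose2[OF maxsol_props(5)[OF u]]
       continuous_on_compose2[OF maxsol_props(6)[OF u]] continuous_intros; auto)+
  have "u (T + T) = u (T - T) \<and> v (T + T) = - v (T - T)"
    by (rule solutions_agree[OF f, of T "\<lambda>s. u (T + s)" "\<lambda>s. v (T + s)" "\<lambda>s. u (T - s)" "\<lambda>s. - v (T - s)"])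
       (use T(1) vT in \<open>auto intro!: shift contshift time_reversal[OF u T(2)] time_reversal_continuous[OF u T(2)]\<close>)
  then have T2: "u (2 * T) = x" "v (2 * T) = 0"
    using maxsol_props(2,3)[OF u] by simp_all
  have per: "u (s + 2 * T) = u s" if "0 \<le> s" for s
  proof -
    have "u (2 * T + s) = u s \<and> v (2 * T + s) = v s"
      by (rule solutions_agree[OF f that, of "\<lambda>s. u (2 * T + s)" "\<lambda>s. v (2 * T + s)" u v])
         (use T(1) T2 maxsol_props(2,3)[OF u] that in
           \<open>auto intro!: shift contshift maxsol_cont[OF u] maxsol_deriv[OF u]\<close>)
    then show ?thesis by (simp add: add.commute)
  qed
  show thesis
    by (rule that[OF R T(1,3,4) per]) (use trap in auto)
qed

text \<open>
  On reaching the level \<open>b\<close> the solution would have zero velocity by energy conservation. Run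
  backwards in time it would then have the same initial data as the constant solution \<open>b\<close>.
\<close>

lemma avoids_equilibrium:
  assumes f: "lipschitz_on_balls f"
    and u: "maxsol f x R u v" and H: "\<And>y. (H has_real_derivative - f y) (at y)"
    and fb: "f b = 0" and bx: "b < x" and Hb: "H b = H x" and t: "t \<in> half_open R"
  shows "b < u t"
proof (rule ccontr)
  assume "\<not> b < u t"
  have "0 \<le> t" using t by (simp add: half_open_def)
  then obtain T where T: "0 \<le> T" "T \<le> t" "u T = b"
    using IVT2'[of u t b 0] \<open>\<not> b < u t\<close> bx maxsol_props(2)[OF u] maxsol_cont(1)[OF u order_refl t]
    by auto
  then have TR: "T \<in> half_open R" by (intro half_open_downward[OF t])
  have vT: "v T = 0" using energy_conservation[OF u H TR] T(3) Hb by simp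
  have "u (T - T) = b \<and> - v (T - T) = 0"
    by (rule solutions_agree[OF f T(1), of "\<lambda>s. u (T - s)" "\<lambda>s. - v (T - s)" "\<lambda>_. b" "\<lambda>_. 0"])
       (use T vT fb in \<open>auto intro!: time_reversal[OF u TR] time_reversal_continuous[OF u TR] continuous_intros\<close>)
  then show False using maxsol_props(2)[OF u] bx by simp
qed

text \<open>
  A potential that is nonnegative along the solution bounds the speed, so the position stays bounded in
  finite time.
\<close>

lemma bounded_speed_imp_global:
  assumes u: "maxsol f x R u v" and H: "\<And>y. (H has_real_derivative - f y) (at y)"
    and nonneg: "\<And>t. t \<in> half_open R \<Longrightarrow> 0 \<le> H (u t)"
  shows "R = \<infinity>"
proof (rule ccontr)
  assume "R \<noteq> \<infinity>"
  then obtain r where r: "R = ereal r" using maxsol_props(1)[OF u] by (cases R) auto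
  define k where "k = sqrt (2 * H x)"
  have vk: "\<bar>v t\<bar> \<le> k" if "t \<in> half_open R" for t
  proof -
    have "(v t)\<^sup>2 \<le> 2 * H x"
      using energy_conservation[OF u H that] nonneg[OF that] by linarith
    then have "sqrt ((v t)\<^sup>2) \<le> k" unfolding k_def by (rule real_sqrt_le_mono)
    then show ?thesis by simp
  qed
  have "x - k * r \<le> u t \<and> u t \<le> x + k * r" if t: "t \<in> half_open R" for t
  proof -
    have t0: "0 \<le> t" "t \<le> r" using t r by (auto simp: half_open_def)
    have sub: "s \<in> half_open R" if "s \<in> {0..t}" for s
      using that by (intro half_open_downward[OF t]) auto
    have "norm (u t - u 0) \<le> k * norm (t - 0)"
      by (rule field_differentiable_bound[of "{0..t}" u v])
         (use sub vk t0 in \<open>auto intro: solves_derivD(1)[OF maxsol_on_interval[OF u t]]\<close>)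
    moreover have "k * t \<le> k * r" using t0 vk[OF t] by (intro mult_left_mono) auto
    ultimately show ?thesis using t0 maxsol_props(2)[OF u] by (auto simp: abs_le_iff)
  qed
  from maxsol_bounded_imp_global[OF u this] r show False by simp
qed

lemma lipschitz_on_balls_reflect:
  assumes "lipschitz_on_balls f"
  shows "lipschitz_on_balls (\<lambda>y. - f (- y))"
  unfolding lipschitz_on_balls_def
proof
  fix K
  obtain L where L: "L-lipschitz_on {-K..K} f"
    using assms unfolding lipschitz_on_balls_def by blast
  have "L-lipschitz_on {-K..K} (\<lambda>y. - f (- y))"
  proof (rule lipschitz_onI)
    show "dist (- f (- x)) (- f (- y)) \<le> L * dist x y" if "x \<in> {-K..K}" "y \<in> {-K..K}" for x y
      using lipschitz_onD[OF L, of "- x" "- y"] that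
      by (simp add: dist_real_def abs_minus_commute)
  qed (rule lipschitz_on_nonneg[OF L])
  then show "\<exists>L. L-lipschitz_on {-K..K} (\<lambda>y. - f (- y))" by blast
qed

text \<open>
  Reflecting the position exchanges the two signs of \<open>f(x)\<close>, so that it is enough to study
  solutions that start downwards.
\<close>

lemma maxsol_reflect:
  assumes "maxsol f x R u v"
  shows "maxsol (\<lambda>y. - f (- y)) (- x) R (\<lambda>t. - u t) (\<lambda>t. - v t)"
proof -
  have "bounded ((\<lambda>t. - u t) ` half_open R) = bounded (u ` half_open R)"
    using bounded_uminus[of "u ` half_open R"] by (simp add: image_image)
  with assms show ?thesis
    unfolding maxsol_def solves_def by (auto intro: DERIV_minus)
qed

lemma potential_reflect:
  fixes H f :: "real \<Rightarrow> real"
  assumes "\<And>y. (H has_real_derivative - f y) (at y)"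
  shows "((\<lambda>y. H (- y)) has_real_derivative - (- f (- y))) (at y)"
  using assms[of "- y"] unfolding DERIV_mirror by simp

lemma unbounded_decrease_at_left:
  fixes u :: "real \<Rightarrow> real"
  assumes R: "0 < R" and mono: "strict_antimono_on (half_open R) u"
    and unb: "\<And>c. \<exists>t\<in>half_open R. u t < c"
  shows "filterlim (\<lambda>r. u (real_of_ereal r)) at_bot (at_left R)"
  unfolding filterlim_at_bot
proof
  fix c
  obtain t where t: "t \<in> half_open R" "u t < c" using unb by blast
  have "ereal t < R" using t by (simp add: half_open_def)
  then show "eventually (\<lambda>r. u (real_of_ereal r) \<le> c) (at_left R)"
    unfolding eventually_at_left[OF R]
  proof (intro exI[of _ "ereal t"] conjI allI impI)
    fix r assume r: "ereal t < r" "r < R"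
    then obtain s where s: "r = ereal s" by (cases r) auto
    have "s \<in> half_open R" using r s t by (auto simp: half_open_def)
    then have "u s < u t" using monotone_onD[OF mono t(1)] r s by auto
    then show "u (real_of_ereal r) \<le> c" using t(2) s by simp
  qed auto
qed

text \<open>
  There is no barrier below \<open>x\<close>: \<open>descent\<close> with \<open>b = -\<infinity>\<close>. It covers
  finite and infinite life span alike.
\<close>

lemma unconfined_escape:
  assumes u: "maxsol f x R u v" and H: "\<And>y. (H has_real_derivative - f y) (at y)"
    and fx: "f x < 0" and well: "\<And>y. y < x \<Longrightarrow> H y < H x"
  shows "strict_antimono_on (half_open R) u"
    and "filterlim (\<lambda>r. u (real_of_ereal r)) at_bot (at_left R)"
proof -
  have below: "- \<infinity> < ereal (u t)" for t by simp
  show mono: "strict_antimono_on (half_open R) u"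
    by (rule descent(2)[OF u H fx well below])
  have "\<exists>t\<in>half_open R. u t < c" for c
    by (rule descent(3)[OF u H fx well below]) simp_all
  then show "filterlim (\<lambda>r. u (real_of_ereal r)) at_bot (at_left R)"
    by (rule unbounded_decrease_at_left[OF maxsol_props(1)[OF u] mono])
qed

lemma unconfined_escape_abs:
  assumes u: "maxsol f x R u v" and H: "\<And>y. (H has_real_derivative - f y) (at y)"
    and fx: "f x < 0" and well: "\<And>y. y < x \<Longrightarrow> H y < H x" and x: "x < 0"
  shows "strict_mono_on (half_open R) (\<lambda>r. \<bar>u r\<bar>)"
    and "filterlim (\<lambda>r. \<bar>u (real_of_ereal r)\<bar>) at_top (at_left R)"
proof -
  note mono = unconfined_escape(1)[OF u H fx well] and lim = unconfined_escape(2)[OF u H fx well]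
  have zero: "0 \<in> half_open R" by (rule zero_in_half_open[OF maxsol_props(1)[OF u]])
  have neg: "u t < 0" if "t \<in> half_open R" for t
    using monotone_onD[OF mono zero that] maxsol_props(2)[OF u] x that
    by (cases "t = 0") (auto simp: half_open_def)
  show "strict_mono_on (half_open R) (\<lambda>r. \<bar>u r\<bar>)"
  proof (rule monotone_onI)
    fix s t assume st: "s \<in> half_open R" "t \<in> half_open R" "s < t"
    show "\<bar>u s\<bar> < \<bar>u t\<bar>"
      using monotone_onD[OF mono st] neg[OF st(1)] neg[OF st(2)] by simp
  qed
  have "filterlim (\<lambda>r. - u (real_of_ereal r)) at_top (at_left R)"
    using lim by (simp add: filterlim_uminus_at_bot)
  then show "filterlim (\<lambda>r. \<bar>u (real_of_ereal r)\<bar>) at_top (at_left R)"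
    by (rule filterlim_at_top_mono) (auto intro: always_eventually)
qed

section \<open>Oscillation and the supremum norm\<close>

lemma periodic_with_zero:
  fixes u :: "real \<Rightarrow> real"
  assumes T: "0 < T" and per: "\<And>s. 0 \<le> s \<Longrightarrow> u (s + T) = u s" and z: "0 \<le> z" "u z = 0"
  shows "oscillating u" "periodic_halfline u"
proof -
  show "periodic_halfline u" unfolding periodic_halfline_def using T per by blast
  have u0: "u (z + real n * T) = 0" for n
  proof (induction n)
    case (Suc n)
    have "u (z + real n * T + T) = u (z + real n * T)"
      using z(1) T by (intro per) auto
    with Suc show ?case by (simp add: algebra_simps)
  qed (simp add: z)
  have "\<not> bounded (range (\<lambda>n. z + real n * T))"
  proof
    assume "bounded (range (\<lambda>n. z + real n * T))"
    then obtain B where B: "\<bar>z + real n * T\<bar> \<le> B" for n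
      unfolding bounded_iff by auto
    obtain n where "B / T < real n" using reals_Archimedean2 by blast
    then have "B < real n * T" using T by (simp add: field_simps)
    with B[of n] z(1) show False by linarith
  qed
  then show "oscillating u"
    unfolding oscillating_def using u0 z(1) T
    by (intro exI[of _ "\<lambda>n. z + real n * T"]) auto
qed

text \<open>
  By continuity \<open>|u|\<close> exceeds any number less than its maximum on an interval to the right of the
  maximum point, which is not a null set.
\<close>

lemma Linf_norm_attained:
  assumes cont: "continuous_on {0..} u" and le: "\<And>t. 0 \<le> t \<Longrightarrow> \<bar>u t\<bar> \<le> K"
    and t0: "0 \<le> t0" "\<bar>u t0\<bar> = K"
  shows "Linf_norm_halfline u = ereal K"
  unfolding Linf_norm_halfline_def
proof (rule antisym)
  let ?M = "lebesgue_on {0::real..}" and ?f = "\<lambda>r. ereal \<bar>u r\<bar>"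
  have "(\<lambda>r. \<bar>u r\<bar>) \<in> borel_measurable ?M"
    by (intro continuous_imp_measurable_on_sets_lebesgue continuous_intros cont) auto
  then have meas: "?f \<in> borel_measurable ?M" by measurable
  show "esssup ?M ?f \<le> ereal K"
    using le by (intro esssup_I meas AE_I2) auto
  show "ereal K \<le> esssup ?M ?f"
  proof (rule ccontr)
    assume "\<not> ereal K \<le> esssup ?M ?f"
    then obtain c where c: "esssup ?M ?f < ereal c" "c < K"
      by (metis ereal_dense2 less_ereal.simps(1) not_le)
    have "continuous (at t0 within {0..}) (\<lambda>r. \<bar>u r\<bar>)"
      using cont t0 by (intro continuous_intros) (auto simp: continuous_on_eq_continuous_within)
    then obtain d where d: "0 < d"
      "\<And>t. 0 \<le> t \<Longrightarrow> dist t t0 < d \<Longrightarrow> dist \<bar>u t\<bar> \<bar>u t0\<bar> < K - c"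
      using c(2) unfolding continuous_within_eps_delta by (metis atLeast_iff diff_gt_0_iff_gt)
    have big: "c < \<bar>u t\<bar>" if "t \<in> {t0<..<t0 + d}" for t
      using d(2)[of t] that t0 by (auto simp: dist_real_def)
    have "AE t in ?M. ?f t \<le> esssup ?M ?f" by (rule esssup_AE)
    then have "AE t in ?M. t \<notin> {t0<..<t0 + d}"
    proof (rule AE_mp, intro AE_I2 impI notI)
      fix t assume "?f t \<le> esssup ?M ?f" "t \<in> {t0<..<t0 + d}"
      with big[of t] c(1) show False
        by (metis less_ereal.simps(1) less_imp_le not_le order_trans)
    qed
    then have "{t0<..<t0 + d} \<in> null_sets ?M"
      using t0 d by (subst AE_iff_null_sets) (auto simp: sets_restrict_space)
    then have "emeasure ?M {t0<..<t0 + d} = 0" by auto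
    moreover have "emeasure ?M {t0<..<t0 + d} = emeasure lebesgue {t0<..<t0 + d}"
      using t0 by (intro emeasure_restrict_space) auto
    ultimately show False using d(1) by simp
  qed
qed

section \<open>The force and the potential of the Pucci equation\<close>

lemma primitive_deriv:
  assumes "continuous_on UNIV h"
  shows "(primitive h has_real_derivative h x) (at x)"
proof -
  let ?a = "- \<bar>x\<bar> - 1" and ?b = "\<bar>x\<bar> + 1"
  have "(primitive h has_vector_derivative h x) (at x within {?a..?b})"
    unfolding primitive_def[abs_def]
    by (rule interval_integral_FTC2) (use assms in \<open>auto intro: continuous_on_subset\<close>)
  moreover have "at x within {?a..?b} = at x"
    by (rule at_within_interior) (auto simp: interior_atLeastAtMost_real)
  ultimately show ?thesis by (simp add: has_real_derivative_iff_has_vector_derivative)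
qed

lemma primitive_0: "primitive h 0 = 0"
  by (simp add: primitive_def)

lemma ereal_scale:
  assumes "0 < l"
  shows "ereal p < ereal l * E \<longleftrightarrow> ereal (p / l) < E"
    and "ereal p = ereal l * E \<longleftrightarrow> ereal (p / l) = E"
    and "ereal l * E < ereal p \<longleftrightarrow> E < ereal (p / l)"
  using assms by (cases E; auto simp: field_simps)+

locale pucci_problem =
  fixes lam Lam :: real and g :: "real \<Rightarrow> real" and \<alpha> :: ereal
  assumes lam: "0 < lam" "lam \<le> Lam"
    and lip: "local_lipschitz (UNIV :: real set) UNIV (\<lambda>_. g)"
    and odd: "\<And>x. g (- x) = - g x"
    and \<alpha>0: "0 < \<alpha>"
    and gpos: "\<And>x. 0 < x \<Longrightarrow> ereal x < \<alpha> \<Longrightarrow> 0 < g x"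
    and gneg: "\<And>x. \<alpha> < ereal x \<Longrightarrow> g x < 0"
begin

text \<open>
  The second derivative that the equation prescribes at position \<open>x\<close>, i.e. the solution
  \<open>m\<close> of \<open>pucci_plus lam Lam m + g x = 0\<close>.
\<close>

definition accel :: "real \<Rightarrow> real" where
  "accel x = (if g x \<le> 0 then - g x / Lam else - g x / lam)"

abbreviation G :: "real \<Rightarrow> real" where "G \<equiv> primitive g"

definition pot :: "real \<Rightarrow> real" where
  "pot = primitive (\<lambda>y. - accel y)"

lemma Lam: "0 < Lam" using lam by simp

lemma lipschitz_g: "lipschitz_on_balls g"
  unfolding lipschitz_on_balls_def
proof
  fix K :: real
  have *: "local_lipschitz {0::real} {-K..K} (\<lambda>_. g)"
    by (rule local_lipschitz_subset[OF lip]) auto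
  obtain L where "L-lipschitz_on {-K..K} g"
    by (rule local_lipschitz_compact_implies_lipschitz[OF *]) auto
  then show "\<exists>L. L-lipschitz_on {-K..K} g" by blast
qed

text \<open>
  \<open>accel\<close> is \<open>- g\<close> followed by the piecewise linear inverse of the Pucci operator,
  whose slopes are \<open>1 / Lam\<close> and \<open>1 / lam\<close>.
\<close>

lemma accel_diff: "\<bar>accel x - accel y\<bar> \<le> \<bar>g x - g y\<bar> / lam"
proof -
  have "1 / Lam \<le> 1 / lam" using lam by (simp add: frac_le)
  have *: "\<bar>accel x - accel y\<bar> \<le> \<bar>g x - g y\<bar> / lam" if "g x \<le> g y" for x y
  proof -
    have scaled: "c / Lam \<le> c / lam" "0 \<le> c / Lam" if "0 \<le> c" for c
      using mult_left_mono[OF \<open>1 / Lam \<le> 1 / lam\<close> that] that Lam by simp_all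
    consider "0 < g x" | "g x \<le> 0" "0 < g y" | "g y \<le> 0" by linarith
    then have "accel y \<le> accel x \<and> accel x - accel y \<le> (g y - g x) / lam"
    proof cases
      case 1
      then show ?thesis
        using that lam by (simp add: accel_def diff_divide_distrib divide_right_mono)
    next
      case 2
      then show ?thesis
        using scaled[of "- g x"] scaled[of "g y"] by (simp add: accel_def diff_divide_distrib)
    next
      case 3
      then show ?thesis
        using that scaled[of "g y - g x"] by (simp add: accel_def diff_divide_distrib)
    qed
    then show ?thesis using that by simp
  qed
  show ?thesis
    using *[of x y] *[of y x] by (cases "g x \<le> g y") (auto simp: abs_minus_commute)
qed

lemma lipschitz_accel: "lipschitz_on_balls accel"
  unfolding lipschitz_on_balls_def
proof
  fix K :: real
  obtain L where L: "L-lipschitz_on {-K..K} g"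
    using lipschitz_g unfolding lipschitz_on_balls_def by blast
  have "(L / lam)-lipschitz_on {-K..K} accel"
  proof (rule lipschitz_onI)
    fix x y assume xy: "x \<in> {-K..K}" "y \<in> {-K..K}"
    have "\<bar>accel x - accel y\<bar> \<le> \<bar>g x - g y\<bar> / lam" by (rule accel_diff)
    also have "\<dots> \<le> L * dist x y / lam"
      using lipschitz_onD[OF L xy] lam by (intro divide_right_mono) (auto simp: dist_real_def)
    finally show "dist (accel x) (accel y) \<le> L / lam * dist x y"
      by (simp add: dist_real_def)
  qed (use lipschitz_on_nonneg[OF L] lam in auto)
  then show "\<exists>L. L-lipschitz_on {-K..K} accel" by blast
qed

lemma pucci_accel: "pucci_plus lam Lam (accel x) + g x = 0"
proof -
  show ?thesis
  proof (cases "g x \<le> 0")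
    case True
    then have "accel x = - g x / Lam" "0 \<le> accel x"
      using Lam by (auto simp: accel_def divide_nonpos_pos)
    then show ?thesis using Lam by (simp add: pucci_plus_def)
  next
    case False
    then have "accel x = - g x / lam" "accel x < 0"
      using lam by (auto simp: accel_def)
    then show ?thesis using lam by (simp add: pucci_plus_def)
  qed
qed

lemma accel_simps:
  "0 < g x \<Longrightarrow> accel x = - g x / lam" "g x < 0 \<Longrightarrow> accel x = - g x / Lam"
  "g x = 0 \<Longrightarrow> accel x = 0"
  by (auto simp: accel_def)

lemma accel_sign: "0 < g x \<Longrightarrow> accel x < 0" "g x < 0 \<Longrightarrow> 0 < accel x"
  using lam Lam by (auto simp: accel_def divide_neg_pos)

lemma continuous_g: "continuous_on UNIV g"
  by (rule lipschitz_on_balls_continuous[OF lipschitz_g])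

lemma G_deriv: "(G has_real_derivative g x) (at x)"
  by (rule primitive_deriv[OF continuous_g])

lemma pot_deriv: "(pot has_real_derivative - accel x) (at x)"
  unfolding pot_def
  by (rule primitive_deriv)
     (intro continuous_intros lipschitz_on_balls_continuous[OF lipschitz_accel])

lemma continuous_on_G: "continuous_on S G"
  using G_deriv by (intro DERIV_continuous_on[where D = g]) (auto intro: has_field_derivative_at_within)

lemma continuous_on_pot: "continuous_on S pot"
  using pot_deriv
  by (intro DERIV_continuous_on[where D = "\<lambda>x. - accel x"]) (auto intro: has_field_derivative_at_within)

lemma maximal_solution_pucci: "maxsol accel \<xi> R u v \<Longrightarrow> maximal_solution lam Lam g \<xi> R u"
  by (rule maxsol_imp_maximal_solution[OF _ lipschitz_on_balls_continuous[OF lipschitz_accel] pucci_accel])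

lemma less_imp_below_\<alpha>: "ereal y \<le> \<alpha> \<Longrightarrow> x < y \<Longrightarrow> ereal x < \<alpha>"
  by (meson less_ereal.simps(1) less_le_trans)

text \<open>
  On the right half of the well \<open>g > 0\<close>, so solutions feel the constant \<open>lam\<close>.
\<close>

lemma pot_pos:
  assumes "0 \<le> x" "ereal x \<le> \<alpha>"
  shows "pot x = G x / lam"
proof (cases "x = 0")
  case False
  then have "0 < x" using assms by simp
  then have "pot x - G x / lam = pot 0 - G 0 / lam"
  proof (rule DERIV_isconst_end[where f = "\<lambda>x. pot x - G x / lam"])
    fix y assume y: "0 < y" "y < x"
    then have "0 < g y" using less_imp_below_\<alpha> assms(2) gpos by blast
    then show "((\<lambda>x. pot x - G x / lam) has_real_derivative 0) (at y)"
      using lam by (auto intro!: derivative_eq_intros pot_deriv G_deriv simp: accel_simps)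
  qed (use lam in \<open>auto intro!: continuous_intros continuous_on_pot continuous_on_G\<close>)
  then show ?thesis by (simp add: pot_def primitive_0)
qed (simp add: pot_def primitive_0)

text \<open>
  On the left half of the well \<open>g < 0\<close>, so solutions feel the constant \<open>Lam\<close>. Together
  with \<open>pot_pos\<close> this makes \<open>lam * G \<eta> = Lam * G \<xi>\<close> the condition for
  \<open>- \<eta>\<close> and \<open>\<xi>\<close> to have equal potential.
\<close>

lemma pot_neg:
  assumes "0 \<le> x" "ereal x \<le> \<alpha>"
  shows "pot (- x) = G x / Lam"
proof (cases "x = 0")
  case False
  then have "0 < x" using assms by simp
  have D: "((\<lambda>y. pot (- y)) has_real_derivative accel (- y)) (at y)" for y
    using potential_reflect[OF pot_deriv] by simp
  from \<open>0 < x\<close> have "pot (- x) - G x / Lam = pot (- 0) - G 0 / Lam"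
  proof (rule DERIV_isconst_end[where f = "\<lambda>x. pot (- x) - G x / Lam"])
    fix y assume y: "0 < y" "y < x"
    then have "g (- y) < 0" using less_imp_below_\<alpha> assms(2) gpos odd by force
    then show "((\<lambda>x. pot (- x) - G x / Lam) has_real_derivative 0) (at y)"
      using Lam by (auto intro!: derivative_eq_intros D G_deriv simp: accel_simps odd)
  qed (use Lam in \<open>auto intro!: continuous_intros continuous_on_G
        continuous_on_compose2[OF continuous_on_pot[of UNIV]]\<close>)
  then show ?thesis by (simp add: pot_def primitive_0)
qed (simp add: pot_def primitive_0)

lemma G_strict_mono:
  assumes "0 \<le> x" "x < y" "ereal y \<le> \<alpha>"
  shows "G x < G y"
proof (rule DERIV_pos_imp_increasing_open[OF assms(2)])
  fix z assume "x < z" "z < y"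
  then have "0 < g z" using assms less_imp_below_\<alpha> gpos by force
  then show "\<exists>d. (G has_real_derivative d) (at z) \<and> 0 < d" using G_deriv by blast
qed (rule continuous_on_G)

lemma pot_less_neg_side:
  assumes "- \<alpha> \<le> ereal y" "y \<le> 0" "0 < \<xi>" "ereal \<xi> < \<alpha>" "G (- y) < Lam * G \<xi> / lam"
  shows "pot y < pot \<xi>"
proof -
  have "ereal (- y) \<le> \<alpha>" using assms(1) by (metis ereal_uminus_le_reorder uminus_ereal.simps(1))
  then have "pot y = G (- y) / Lam" using pot_neg[of "- y"] assms(2) by simp
  also have "\<dots> < G \<xi> / lam" using assms(5) lam Lam by (simp add: field_simps)
  also have "\<dots> = pot \<xi>" using pot_pos[of \<xi>] assms by simp
  finally show ?thesis .
qed

lemma pot_less_pos_side: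
  assumes "0 \<le> y" "y < \<xi>" "ereal \<xi> < \<alpha>"
  shows "pot y < pot \<xi>"
  using pot_pos[of y] pot_pos[of \<xi>] G_strict_mono[of y \<xi>] assms less_imp_below_\<alpha>[of \<xi> y] lam
  by (simp add: divide_strict_right_mono less_imp_le)

text \<open>
  \<open>G\<close> is increasing on the half-line, so its limit exists and is the supremum. The next two lemmas
  then treat finite and infinite \<open>\<alpha>\<close> uniformly.
\<close>

lemma primitive_ext_at_top:
  assumes "\<alpha> = \<infinity>"
  shows "primitive_ext g \<alpha> = (SUP t\<in>{0..}. ereal (G t))"
proof -
  have "((\<lambda>t. ereal (G t)) \<longlongrightarrow> (SUP t\<in>{0..}. ereal (G t))) at_top"
  proof (rule order_tendstoI)
    fix a assume "a < (SUP t\<in>{0..}. ereal (G t))"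
    then obtain s where s: "0 \<le> s" "a < ereal (G s)" by (auto simp: less_SUP_iff)
    have "a < ereal (G t)" if "s \<le> t" for t
      using G_strict_mono[of s t] s that assms by (cases "s = t") (auto intro: less_trans)
    then show "eventually (\<lambda>t. a < ereal (G t)) at_top"
      unfolding eventually_at_top_linorder by blast
  next
    fix a assume "(SUP t\<in>{0..}. ereal (G t)) < a"
    then have "ereal (G t) < a" if "0 \<le> t" for t
      using that by (meson SUP_upper atLeast_iff le_less_trans)
    then show "eventually (\<lambda>t. ereal (G t) < a) at_top"
      unfolding eventually_at_top_linorder by blast
  qed
  then have "Lim at_top (\<lambda>t. ereal (G t)) = (SUP t\<in>{0..}. ereal (G t))"
    by (intro tendsto_Lim) auto
  then show ?thesis using assms by (simp add: primitive_ext_def)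
qed

lemma G_less_primitive_ext:
  assumes "0 \<le> t" "ereal t < \<alpha>"
  shows "ereal (G t) < primitive_ext g \<alpha>"
proof (cases "\<alpha> = \<infinity>")
  case True
  have "ereal (G t) < ereal (G (t + 1))" using G_strict_mono[of t "t + 1"] assms True by simp
  also have "\<dots> \<le> primitive_ext g \<alpha>"
    unfolding primitive_ext_at_top[OF True] using assms by (intro SUP_upper) auto
  finally show ?thesis .
next
  case False
  then obtain a where "\<alpha> = ereal a" using \<alpha>0 by (cases \<alpha>) auto
  then show ?thesis using G_strict_mono[of t a] assms by (simp add: primitive_ext_def)
qed

lemma primitive_ext_approx:
  assumes "ereal y < primitive_ext g \<alpha>"
  obtains t where "0 \<le> t" "ereal t \<le> \<alpha>" "y < G t"
proof (cases "\<alpha> = \<infinity>")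
  case True
  from assms[unfolded primitive_ext_at_top[OF True]] obtain t where "0 \<le> t" "y < G t"
    by (auto simp: less_SUP_iff)
  with True show thesis using that by simp
next
  case False
  then obtain a where "\<alpha> = ereal a" "0 < a" using \<alpha>0 by (cases \<alpha>) auto
  then show thesis using that[of a] assms by (simp add: primitive_ext_def)
qed

lemma G_level:
  assumes "0 < y" "0 \<le> t" "ereal t \<le> \<alpha>" "y < G t"
  obtains \<eta> where "0 < \<eta>" "\<eta> < t" "G \<eta> = y"
proof -
  obtain \<eta> where \<eta>: "0 \<le> \<eta>" "\<eta> \<le> t" "G \<eta> = y"
    using IVT'[of G 0 y t] assms continuous_on_G by (auto simp: primitive_0)
  then show thesis
    using that[of \<eta>] assms by (cases "\<eta> = 0"; cases "\<eta> = t") (auto simp: primitive_0)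
qed

text \<open>
  At \<open>\<plusminus>\<alpha>\<close> the hypotheses on \<open>g\<close> say nothing about its value, but it
  changes sign there and is continuous.
\<close>

lemma g_zero:
  assumes "ereal \<bar>\<xi>\<bar> = \<alpha> \<or> \<xi> = 0"
  shows "g \<xi> = 0"
proof (cases "\<xi> = 0")
  case True
  then show ?thesis using odd[of 0] by simp
next
  case False
  define a where "a = \<bar>\<xi>\<bar>"
  have a: "\<alpha> = ereal a" "0 < a" using False assms by (auto simp: a_def)
  have "isCont g a" using continuous_g by (simp add: continuous_on_eq_continuous_at)
  then have lim: "(g \<longlongrightarrow> g a) (at_left a)" "(g \<longlongrightarrow> g a) (at_right a)"
    by (auto simp: isCont_def filterlim_at_split)
  have "eventually (\<lambda>x. 0 \<le> g x) (at_left a)"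
    unfolding eventually_at_left[OF a(2)]
    using a gpos by (intro exI[of _ 0]) (auto intro: less_imp_le)
  then have "0 \<le> g a" by (intro tendsto_lowerbound[OF lim(1)]) auto
  moreover have "eventually (\<lambda>x. g x \<le> 0) (at_right a)"
    unfolding eventually_at_right_field
    using a gneg by (intro exI[of _ "a + 1"]) (auto intro: less_imp_le)
  then have "g a \<le> 0" by (intro tendsto_upperbound[OF lim(2)]) auto
  ultimately have "g a = 0" by simp
  then show ?thesis using odd[of a] by (auto simp: a_def abs_if split: if_splits)
qed

section \<open>The classification\<close>

lemma constant_solution:
  assumes "ereal \<bar>\<xi>\<bar> = \<alpha> \<or> \<xi> = 0"
  shows "maximal_solution lam Lam g \<xi> \<infinity> (\<lambda>_. \<xi>)"
proof (rule maximal_solution_pucci)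
  show "maxsol accel \<xi> \<infinity> (\<lambda>_. \<xi>) (\<lambda>_. 0)"
    unfolding maxsol_def solves_def using accel_simps(3)[OF g_zero[OF assms]] by simp
qed

text \<open>
  Outside the well the potential falls off on both sides, so there is no barrier: to the left of
  \<open>-\<alpha>\<close> directly, to the right of \<open>\<alpha>\<close> after reflection.
\<close>

lemma outside_blow_up:
  assumes "\<alpha> < ereal \<bar>\<xi>\<bar>" and u: "maxsol accel \<xi> R u v"
  shows "strict_mono_on (half_open R) (\<lambda>r. \<bar>u r\<bar>)"
    and "filterlim (\<lambda>r. \<bar>u (real_of_ereal r)\<bar>) at_top (at_left R)"
proof -
  have ne: "\<xi> \<noteq> 0" using assms \<alpha>0 by (auto simp flip: zero_ereal_def)
  show "strict_mono_on (half_open R) (\<lambda>r. \<bar>u r\<bar>)"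
    and "filterlim (\<lambda>r. \<bar>u (real_of_ereal r)\<bar>) at_top (at_left R)"
  proof (atomize(full), cases "\<xi> < 0")
    case True
    have pos: "0 < g y" if "y \<le> \<xi>" for y
    proof -
      have "\<alpha> < ereal (- y)" using assms(1) True that by (auto intro: less_le_trans)
      then show ?thesis using gneg[of "- y"] odd[of y] by simp
    qed
    have well: "pot y < pot \<xi>" if "y < \<xi>" for y
    proof (rule DERIV_pos_imp_increasing_open[OF that])
      show "\<exists>d. (pot has_real_derivative d) (at z) \<and> 0 < d" if "y < z" "z < \<xi>" for z
        using pot_deriv[of z] accel_sign(1)[OF pos[of z]] that
        by (intro exI[of _ "- accel z"]) auto
    qed (rule continuous_on_pot)
    note * = unconfined_escape_abs[OF u pot_deriv accel_sign(1)[OF pos[OF order_refl]] well True]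
    show "strict_mono_on (half_open R) (\<lambda>r. \<bar>u r\<bar>) \<and>
      filterlim (\<lambda>r. \<bar>u (real_of_ereal r)\<bar>) at_top (at_left R)"
      using * by blast
  next
    case False
    then have \<xi>: "- \<xi> < 0" using ne by simp
    have neg: "g y < 0" if "\<xi> \<le> y" for y
      using assms(1) False that by (intro gneg) (auto intro: less_le_trans)
    have well: "pot (- y) < pot (- (- \<xi>))" if "y < - \<xi>" for y
    proof (rule DERIV_neg_imp_decreasing_open[where f = pot])
      show "\<exists>d. (pot has_real_derivative d) (at z) \<and> d < 0" if "- (- \<xi>) < z" "z < - y" for z
        using pot_deriv[of z] accel_sign(2)[OF neg[of z]] that
        by (intro exI[of _ "- accel z"]) auto
    qed (use that continuous_on_pot in auto)
    have start: "- accel (- (- \<xi>)) < 0" using accel_sign(2)[OF neg[OF order_refl]] by simp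
    note * = unconfined_escape_abs[OF maxsol_reflect[OF u] potential_reflect[OF pot_deriv] start well \<xi>]
    show "strict_mono_on (half_open R) (\<lambda>r. \<bar>u r\<bar>) \<and>
      filterlim (\<lambda>r. \<bar>u (real_of_ereal r)\<bar>) at_top (at_left R)"
      using * by simp
  qed
qed

text \<open>
  The condition says that the left rim of the well is higher than the starting level. The turning level
  is \<open>- \<eta>\<close> with \<open>lam * G \<eta> = Lam * G \<xi>\<close>. Because \<open>lam \<le> Lam\<close>, the
  excursion to the left is at least as large as \<open>\<xi>\<close>, so the norm is attained at the minimum.
\<close>

lemma positive_start_oscillates:
  assumes \<xi>: "0 < \<xi>" "ereal \<xi> < \<alpha>" and u: "maxsol accel \<xi> R u v"
    and small: "ereal (Lam * G \<xi> / lam) < primitive_ext g \<alpha>"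
  shows "R = \<infinity>" "oscillating u" "periodic_halfline u"
    "\<exists>r. first_minimizer u r \<and> Linf_norm_halfline u = ereal (- u r) \<and> ereal (- u r) < \<alpha>"
proof -
  have G0: "0 < G \<xi>" using G_strict_mono[of 0 \<xi>] \<xi> by (simp add: primitive_0)
  then have lev: "0 < Lam * G \<xi> / lam" using lam Lam by simp
  obtain t where t: "0 \<le> t" "ereal t \<le> \<alpha>" "Lam * G \<xi> / lam < G t"
    using primitive_ext_approx[OF small] .
  obtain \<eta> where \<eta>: "0 < \<eta>" "\<eta> < t" "G \<eta> = Lam * G \<xi> / lam"
    using G_level[OF lev t] .
  have \<eta>\<alpha>: "ereal \<eta> < \<alpha>" using less_imp_below_\<alpha> t \<eta> by blast
  have "G \<xi> \<le> G \<eta>"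
    using G0 lam Lam unfolding \<eta>(3) by (simp add: field_simps)
  then have \<xi>\<eta>: "\<xi> \<le> \<eta>" using G_strict_mono[of \<eta> \<xi>] \<eta> \<xi> by (meson less_imp_le not_le)
  have fx: "accel \<xi> < 0" by (rule accel_sign(1)[OF gpos[OF \<xi>]])
  have fb: "0 < accel (- \<eta>)" using gpos[OF \<eta>(1) \<eta>\<alpha>] by (intro accel_sign(2)) (simp add: odd)
  have Hb: "pot (- \<eta>) = pot \<xi>"
    using pot_neg[of \<eta>] pot_pos[of \<xi>] \<eta> \<eta>\<alpha> \<xi> Lam by simp
  have well: "pot y < pot \<xi>" if "- \<eta> < y" "y < \<xi>" for y
  proof (cases "0 \<le> y")
    case True
    then show ?thesis using pot_less_pos_side that \<xi> by blast
  next
    case False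
    then have "ereal (- y) \<le> \<alpha>" using that less_imp_below_\<alpha>[OF less_imp_le[OF \<eta>\<alpha>], of "- y"] by simp
    then have "- \<alpha> \<le> ereal y" by (metis ereal_uminus_le_reorder uminus_ereal.simps(1))
    moreover have "G (- y) < G \<eta>" using that False \<eta>\<alpha> by (intro G_strict_mono) auto
    ultimately show ?thesis
      using False \<xi> \<eta>(3) by (intro pot_less_neg_side) auto
  qed
  have "- \<eta> < \<xi>" using \<eta> \<xi> by simp
  from periodic_solution[OF lipschitz_accel u pot_deriv fx fb this Hb well]
  obtain T where R: "R = \<infinity>" and T: "0 < T" "u T = - \<eta>" "\<And>s. 0 \<le> s \<Longrightarrow> s < T \<Longrightarrow> - \<eta> < u s"
    and per: "\<And>s. 0 \<le> s \<Longrightarrow> u (s + 2 * T) = u s" and bd: "\<And>s. 0 \<le> s \<Longrightarrow> - \<eta> \<le> u s \<and> u s \<le> \<xi>"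
    by metis
  show "R = \<infinity>" by (rule R)
  have cont: "continuous_on {0..} u" using maxsol_props(5)[OF u] R half_open_infinity by simp
  obtain z where "0 \<le> z" "u z = 0"
    using IVT2'[of u T 0 0] T \<eta> \<xi> maxsol_props(2)[OF u] continuous_on_subset[OF cont, of "{0..T}"]
    by auto
  with T(1) per show "oscillating u" "periodic_halfline u"
    using periodic_with_zero[of "2 * T" u z] by auto
  have "first_minimizer u T"
    unfolding first_minimizer_def is_arg_min_def
    using T bd by (auto simp: not_less) (metis less_le_not_le not_le)
  moreover have "Linf_norm_halfline u = ereal \<eta>"
    by (rule Linf_norm_attained[OF cont, of \<eta> T]) (use T \<eta> bd \<xi>\<eta> in \<open>force simp: abs_le_iff\<close>)+
  ultimately show "\<exists>r. first_minimizer u r \<and> Linf_norm_halfline u = ereal (- u r) \<and> ereal (- u r) < \<alpha>"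
    using T(2) \<eta>\<alpha> by (intro exI[of _ T]) simp
qed

text \<open>
  The starting level equals the height of the left rim. For finite \<open>\<alpha>\<close> the rim is an
  equilibrium, which the solution approaches without reaching it; for infinite \<open>\<alpha>\<close> there is
  no barrier. In both cases the solution stays where the potential is nonnegative, so its speed is bounded
  and it is global.
\<close>

lemma critical_start_converges:
  assumes \<xi>: "0 < \<xi>" "ereal \<xi> < \<alpha>" and u: "maxsol accel \<xi> R u v"
    and crit: "ereal (Lam * G \<xi> / lam) = primitive_ext g \<alpha>"
  shows "R = \<infinity>" "\<And>r. 0 \<le> r \<Longrightarrow> - \<alpha> < ereal (u r) \<and> ereal (u r) < \<alpha>"
    "strict_antimono_on {0..} u" "((\<lambda>r. ereal (u r)) \<longlongrightarrow> - \<alpha>) at_top"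
proof -
  have fx: "accel \<xi> < 0" by (rule accel_sign(1)[OF gpos[OF \<xi>]])
  have well: "pot y < pot \<xi>" if "- \<alpha> < ereal y" "y < \<xi>" for y
  proof (cases "0 \<le> y")
    case True
    then show ?thesis using pot_less_pos_side that \<xi> by blast
  next
    case False
    have "ereal (- y) < \<alpha>" using that(1) by (metis ereal_uminus_less_reorder uminus_ereal.simps(1))
    then have "ereal (G (- y)) < ereal (Lam * G \<xi> / lam)"
      using G_less_primitive_ext[of "- y"] False crit by simp
    then show ?thesis
      using False \<xi> that by (intro pot_less_neg_side) auto
  qed
  have low: "- \<alpha> < ereal (u t)" if "t \<in> half_open R" for t
  proof (cases "\<alpha> = \<infinity>")
    case False
    then obtain a where a: "\<alpha> = ereal a" "0 < a" using \<alpha>0 by (cases \<alpha>) auto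
    have "accel (- a) = 0" using a by (intro accel_simps(3) g_zero) simp
    moreover have "G a = Lam * G \<xi> / lam" using a crit by (simp add: primitive_ext_def)
    then have "pot (- a) = pot \<xi>"
      using pot_neg[of a] pot_pos[of \<xi>] a \<xi> Lam by simp
    ultimately have "- a < u t"
      using avoids_equilibrium[OF lipschitz_accel u pot_deriv, of "- a"] a \<xi> that by simp
    then show ?thesis using a by simp
  qed simp
  have mono: "strict_antimono_on (half_open R) u"
    by (rule descent(2)[OF u pot_deriv fx well low])
  have to: "\<exists>t\<in>half_open R. u t < c" if "- \<alpha> < ereal c" for c
    by (rule descent(3)[OF u pot_deriv fx well low that])
  have zero: "0 \<in> half_open R" by (rule zero_in_half_open[OF maxsol_props(1)[OF u]])
  have le: "u t \<le> \<xi>" if "t \<in> half_open R" for t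
    using monotone_onD[OF mono zero that] maxsol_props(2)[OF u] that
    by (cases "t = 0") (auto simp: half_open_def)
  have up: "ereal (u t) < \<alpha>" if "t \<in> half_open R" for t
    using le[OF that] \<xi> by (meson ereal_less_eq(3) le_less_trans)
  show R: "R = \<infinity>"
  proof (rule bounded_speed_imp_global[OF u pot_deriv])
    fix t assume t: "t \<in> half_open R"
    have nonneg: "0 \<le> G y" if "0 \<le> y" "ereal y \<le> \<alpha>" for y
      using G_strict_mono[of 0 y] that by (cases "y = 0") (auto simp: primitive_0)
    show "0 \<le> pot (u t)"
    proof (cases "0 \<le> u t")
      case True
      then show ?thesis using pot_pos[of "u t"] nonneg[of "u t"] up[OF t] lam by simp
    next
      case False
      have "ereal (- u t) < \<alpha>" using low[OF t] by (metis ereal_uminus_less_reorder uminus_ereal.simps(1))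
      then show ?thesis using pot_neg[of "- u t"] nonneg[of "- u t"] False Lam by simp
    qed
  qed
  note [simp] = R half_open_infinity
  show "- \<alpha> < ereal (u r) \<and> ereal (u r) < \<alpha>" if "0 \<le> r" for r
    using low[of r] up[of r] that by simp
  show "strict_antimono_on {0..} u" using mono by simp
  show "((\<lambda>r. ereal (u r)) \<longlongrightarrow> - \<alpha>) at_top"
  proof (rule order_tendstoI)
    fix a assume "a < - \<alpha>"
    then have "a < ereal (u r)" if "0 \<le> r" for r using low[of r] that by (auto intro: less_trans)
    then show "eventually (\<lambda>r. a < ereal (u r)) at_top"
      unfolding eventually_at_top_linorder by blast
  next
    fix a assume "- \<alpha> < a"
    then obtain c where c: "- \<alpha> < ereal c" "ereal c < a" by (meson ereal_dense2)
    then obtain t0 where t0: "0 \<le> t0" "u t0 < c" using to by auto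
    have "ereal (u r) < a" if "t0 \<le> r" for r
    proof -
      have "u r \<le> u t0" using monotone_onD[OF mono, of t0 r] t0 that by (cases "r = t0") auto
      then have "ereal (u r) < ereal c" using t0 by simp
      then show ?thesis using c(2) by (rule less_trans)
    qed
    then show "eventually (\<lambda>r. ereal (u r) < a) at_top"
      unfolding eventually_at_top_linorder by blast
  qed
qed

text \<open>
  The starting level is above the left rim, so the solution passes over it. Beyond \<open>-\<alpha>\<close>
  the potential only decreases, and there is no barrier at all.
\<close>

lemma large_start_escapes:
  assumes \<xi>: "0 < \<xi>" "ereal \<xi> < \<alpha>" and u: "maxsol accel \<xi> R u v"
    and large: "primitive_ext g \<alpha> < ereal (Lam * G \<xi> / lam)"
  shows "strict_antimono_on (half_open R) u"
    "filterlim (\<lambda>r. u (real_of_ereal r)) at_bot (at_left R)"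
proof -
  have fx: "accel \<xi> < 0" by (rule accel_sign(1)[OF gpos[OF \<xi>]])
  have well: "pot y < pot \<xi>" if "y < \<xi>" for y
  proof -
    consider "0 \<le> y" | "y < 0" "ereal (- y) < \<alpha>" | "y < 0" "\<alpha> \<le> ereal (- y)"
      by (meson not_le)
    then show ?thesis
    proof cases
      case 1
      then show ?thesis using pot_less_pos_side that \<xi> by blast
    next
      case 2
      have "ereal (G (- y)) < ereal (Lam * G \<xi> / lam)"
        using less_trans[OF G_less_primitive_ext[of "- y"] large] 2 by simp
      moreover have "- \<alpha> \<le> ereal y"
        using 2(2) by (metis ereal_uminus_le_reorder less_imp_le uminus_ereal.simps(1))
      ultimately show ?thesis using 2 \<xi> by (intro pot_less_neg_side) auto
    next
      case 3
      then obtain a where a: "\<alpha> = ereal a" "0 < a" "y \<le> - a" using \<alpha>0 by (cases \<alpha>) auto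
      have "pot y \<le> pot (- a)"
      proof (cases "y = - a")
        case False
        then have "y < - a" using a by simp
        then have "pot y < pot (- a)"
        proof (rule DERIV_pos_imp_increasing_open)
          fix z assume z: "y < z" "z < - a"
          then have "0 < g z" using gneg[of "- z"] a odd[of z] by simp
          then show "\<exists>d. (pot has_real_derivative d) (at z) \<and> 0 < d"
            using pot_deriv[of z] accel_sign(1)[of z] by (intro exI[of _ "- accel z"]) auto
        qed (rule continuous_on_pot)
        then show ?thesis by simp
      qed simp
      also have "pot (- a) < pot \<xi>"
        using a large \<xi> by (intro pot_less_neg_side) (auto simp: primitive_ext_def)
      finally show ?thesis .
    qed
  qed
  show "strict_antimono_on (half_open R) u"
    by (rule unconfined_escape(1)[OF u pot_deriv fx well])
  show "filterlim (\<lambda>r. u (real_of_ereal r)) at_bot (at_left R)"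
    by (rule unconfined_escape(2)[OF u pot_deriv fx well])
qed

text \<open>
  After reflection the solution starts downwards from \<open>x = - \<xi>\<close>. The constants change roles:
  the turning level is \<open>- \<eta>\<close> with \<open>Lam * G \<eta> = lam * G x\<close>, so it exists without
  a further condition, \<open>\<eta> \<le> x\<close>, and the norm is attained at time 0.
\<close>

lemma negative_start_oscillates:
  assumes \<xi>: "- \<alpha> < ereal \<xi>" "\<xi> < 0" and u: "maxsol accel \<xi> R u v"
  shows "R = \<infinity>" "oscillating u" "periodic_halfline u" "Linf_norm_halfline u = ereal (- \<xi>)"
proof -
  define x where "x = - \<xi>"
  have x\<alpha>: "ereal x < \<alpha>"
    unfolding x_def using \<xi>(1) by (metis ereal_uminus_less_reorder uminus_ereal.simps(1))
  have x0: "0 < x" using \<xi> by (simp add: x_def)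
  have G0: "0 < G x" using G_strict_mono[of 0 x] x0 x\<alpha> by (simp add: primitive_0)
  have "lam * G x / Lam \<le> G x" using G0 lam Lam by (simp add: field_simps)
  \<comment> \<open>Equality, and hence \<open>\<eta> = x\<close>, occurs exactly if \<open>lam = Lam\<close>.\<close>
  obtain \<eta> where \<eta>: "0 < \<eta>" "\<eta> \<le> x" "G \<eta> = lam * G x / Lam"
  proof (cases "lam * G x / Lam = G x")
    case True
    then show thesis using that[of x] x0 by simp
  next
    case False
    then have "lam * G x / Lam < G x" using \<open>lam * G x / Lam \<le> G x\<close> by simp
    moreover have "0 < lam * G x / Lam" using G0 lam Lam by simp
    ultimately obtain \<eta> where "0 < \<eta>" "\<eta> < x" "G \<eta> = lam * G x / Lam"
      using G_level[of "lam * G x / Lam" x] x0 less_imp_le[OF x\<alpha>] by auto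
    then show thesis using that[of \<eta>] by simp
  qed
  have \<eta>\<alpha>: "ereal \<eta> < \<alpha>" using \<eta>(2) x\<alpha> by (meson ereal_less_eq(3) le_less_trans)
  define w where "w = (\<lambda>t. - u t)"
  have w: "maxsol (\<lambda>y. - accel (- y)) x R w (\<lambda>t. - v t)"
    unfolding w_def x_def by (rule maxsol_reflect[OF u])
  note H = potential_reflect[OF pot_deriv]
  have fx: "- accel (- x) < 0"
    using accel_sign(2)[of "- x"] gpos[OF x0 x\<alpha>] by (simp add: odd)
  have fb: "0 < - accel (- (- \<eta>))" using accel_sign(1)[OF gpos[OF \<eta>(1) \<eta>\<alpha>]] by simp
  have bx: "- \<eta> < x" using \<eta> x0 by simp
  have Hb: "pot (- (- \<eta>)) = pot (- x)"
    using pot_neg[of x] pot_pos[of \<eta>] \<eta> \<eta>\<alpha> x0 x\<alpha> lam by simp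
  have well: "pot (- y) < pot (- x)" if "- \<eta> < y" "y < x" for y
  proof (cases "0 \<le> y")
    case True
    then have "G y < G x" using that x\<alpha> by (intro G_strict_mono) auto
    then show ?thesis
      using pot_neg[of y] pot_neg[of x] True that x0 x\<alpha> less_imp_below_\<alpha>[of x y] Lam
      by (simp add: divide_strict_right_mono less_imp_le)
  next
    case False
    then have "pot (- y) < pot \<eta>" using that \<eta>\<alpha> by (intro pot_less_pos_side) auto
    then show ?thesis using Hb by simp
  qed
  from periodic_solution[OF lipschitz_on_balls_reflect[OF lipschitz_accel] w H fx fb bx Hb well]
  obtain T where R: "R = \<infinity>" and T: "0 < T" "w T = - \<eta>"
    and per: "\<And>s. 0 \<le> s \<Longrightarrow> w (s + 2 * T) = w s" and bd: "\<And>s. 0 \<le> s \<Longrightarrow> - \<eta> \<le> w s \<and> w s \<le> x"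
    by metis
  show "R = \<infinity>" by (rule R)
  have cont: "continuous_on {0..} u" using maxsol_props(5)[OF u] R half_open_infinity by simp
  obtain z where "0 \<le> z" "u z = 0"
    using IVT'[of u 0 0 T] T \<eta> \<xi> maxsol_props(2)[OF u] continuous_on_subset[OF cont, of "{0..T}"]
    by (auto simp: w_def)
  with T(1) per show "oscillating u" "periodic_halfline u"
    using periodic_with_zero[of "2 * T" u z] by (auto simp: w_def)
  have "\<bar>u t\<bar> \<le> x" if "0 \<le> t" for t
    using bd[OF that] \<eta>(2) by (auto simp: w_def abs_le_iff)
  then have "Linf_norm_halfline u = ereal x"
    by (rule Linf_norm_attained[OF cont _ order_refl]) (use maxsol_props(2)[OF u] \<xi> x_def in auto)
  then show "Linf_norm_halfline u = ereal (- \<xi>)" by (simp add: x_def)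
qed

end

theorem theorem2p1:
  fixes lam Lam :: real and g :: "real \<Rightarrow> real" and \<alpha> :: ereal and \<xi> :: real
  assumes ellipticity: "0 < lam" "lam \<le> Lam"
    and g1: "local_lipschitz (UNIV :: real set) UNIV (\<lambda>_. g)"
    and g2: "\<And>x. g (- x) = - g x"
    and g3: "0 < \<alpha>"
      "\<And>x. 0 < x \<Longrightarrow> ereal x < \<alpha> \<Longrightarrow> 0 < g x"
      "\<And>x. \<alpha> < ereal x \<Longrightarrow> g x < 0"
  shows "\<exists>R u. maximal_solution lam Lam g \<xi> R u \<and>
    (ereal \<bar>\<xi>\<bar> = \<alpha> \<or> \<xi> = 0 \<longrightarrow> (\<forall>r\<in>half_open R. u r = \<xi>)) \<and>
    (\<alpha> \<noteq> \<infinity> \<and> \<alpha> < ereal \<bar>\<xi>\<bar> \<longrightarrow>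
       strict_mono_on (half_open R) (\<lambda>r. \<bar>u r\<bar>) \<and>
       filterlim (\<lambda>r. \<bar>u (real_of_ereal r)\<bar>) at_top (at_left R)) \<and>
    (0 < \<xi> \<and> ereal \<xi> < \<alpha> \<longrightarrow>
       (ereal (Lam * primitive g \<xi>) < ereal lam * primitive_ext g \<alpha> \<longrightarrow>
          R = \<infinity> \<and> oscillating u \<and> periodic_halfline u \<and>
          (\<exists>r\<^sub>2. first_minimizer u r\<^sub>2 \<and>
             Linf_norm_halfline u = ereal (- u r\<^sub>2) \<and> ereal (- u r\<^sub>2) < \<alpha>)) \<and>
       (ereal (Lam * primitive g \<xi>) = ereal lam * primitive_ext g \<alpha> \<longrightarrow>
          R = \<infinity> \<and>
          (\<forall>r\<ge>0. - \<alpha> < ereal (u r) \<and> ereal (u r) < \<alpha>) \<and>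
          strict_antimono_on {0..} u \<and>
          ((\<lambda>r. ereal (u r)) \<longlongrightarrow> - \<alpha>) at_top) \<and>
       (ereal (Lam * primitive g \<xi>) > ereal lam * primitive_ext g \<alpha> \<longrightarrow>
          strict_antimono_on (half_open R) u \<and>
          filterlim (\<lambda>r. u (real_of_ereal r)) at_bot (at_left R))) \<and>
    (- \<alpha> < ereal \<xi> \<and> \<xi> < 0 \<longrightarrow>
       R = \<infinity> \<and> oscillating u \<and> periodic_halfline u \<and>
       Linf_norm_halfline u = ereal (- \<xi>))"
proof -
  interpret pucci_problem lam Lam g \<alpha>
    by unfold_locales (fact assms)+
  note scale = ereal_scale[OF ellipticity(1)]
  show ?thesis
  proof (cases "ereal \<bar>\<xi>\<bar> = \<alpha> \<or> \<xi> = 0")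
    case True
    then have "\<not> \<alpha> < ereal \<bar>\<xi>\<bar>" "\<not> (0 < \<xi> \<and> ereal \<xi> < \<alpha>)" "\<not> (- \<alpha> < ereal \<xi> \<and> \<xi> < 0)"
      using g3(1) by (auto simp: zero_ereal_def)
    then show ?thesis
      using constant_solution[OF True] by (intro exI[of _ \<infinity>] exI[of _ "\<lambda>_. \<xi>"]) blast
  next
    case False
    obtain R u v where u: "maxsol accel \<xi> R u v"
      using maximal_solution_exists[OF lipschitz_accel] .
    show ?thesis
    proof (intro exI[of _ R] exI[of _ u] conjI impI; (elim conjE)?)
      show "maximal_solution lam Lam g \<xi> R u" by (rule maximal_solution_pucci[OF u])
    qed (use False outside_blow_up[OF _ u] positive_start_oscillates[OF _ _ u]
        critical_start_converges[OF _ _ u] large_start_escapes[OF _ _ u]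
        negative_start_oscillates[OF _ _ u] in \<open>simp_all add: scale\<close>)
  qed
qed

end
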